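(* Let $\mu$ be the Markov-type measure on the Mauldin–Williams fractal $E$ described in the context, with row-stochastic transition matrix $P=(p_{ij})_{N\times N}$, initial probability vector $(q_i)_{i=1}^N$ (all $q_i>0$) and ratios $c_{ij}\in(0,1)$, $(i,j)\in G_2$. Assume that the separation property (SEP) holds, that ${\rm card}(\{j\in G_1:(i,j)\in G_2\})\ge 2$ for all $i\in G_1$, and that $P$ is irreducible. Let $v=(v_i)_{i=1}^N$ be the unique positive left (row) eigenvector of $P$ for the eigenvalue $1$ with $\sum_{i=1}^N v_i=1$, and put $$s_0:=\frac{\sum_{i=1}^N v_i\sum_{j:(i,j)\in G_2}p_{ij}\log p_{ij}}{\sum_{i=1}^N v_i\sum_{j:(i,j)\in G_2}p_{ij}\log c_{ij}}.$$ Then $D_0(\mu)$ exists, $D_0(\mu)=s_0$, and $$0<\underline{Q}_0^{s_0}(\mu)\le\overline{Q}_0^{s_0}(\mu)<\infty.$$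
   Context: Quantization. Let $d$ be the metric on $\mathbb{R}^q$ induced by a fixed, arbitrary norm. For $n\ge1$ let $\mathcal{D}_n$ be the collection of sets $\alpha\subset\mathbb{R}^q$ with $1\le{\rm card}(\alpha)\le n$. For a Borel probability measure $\nu$ on $\mathbb{R}^q$, the $n$th geometric mean error is $e_{n,0}(\nu):=\inf_{\alpha\in\mathcal{D}_n}\exp\int\log d(x,\alpha)\,d\nu(x)$. For $s>0$, $\overline{Q}_0^s(\nu):=\limsup_{n\to\infty}n^{1/s}e_{n,0}(\nu)$ and $\underline{Q}_0^s(\nu):=\liminf_{n\to\infty}n^{1/s}e_{n,0}(\nu)$. Also $\overline{D}_0(\nu):=\limsup_{n\to\infty}\frac{\log n}{-\log e_{n,0}(\nu)}$ and $\underline{D}_0(\nu):=\liminf_{n\to\infty}\frac{\log n}{-\log e_{n,0}(\nu)}$; if they coincide, the common value is $D_0(\nu)$. Words. Let $P=(p_{ij})_{N\times N}$ be row-stochastic ($p_{ij}\ge0$, $\sum_jp_{ij}=1$). $G_0:=\{\theta\}$ (empty word), $G_1:=\{1,\dots,N\}$, $G_k:=\{\sigma\in G_1^k:p_{\sigma_1\sigma_2}\cdots p_{\sigma_{k-1}\sigma_k}>0\}$ for $k\ge2$, $G^*:=\bigcup_{k\ge0}G_k$, $G_\infty:=\{\sigma\in G_1^{\mathbb{N}}:p_{\sigma_h\sigma_{h+1}}>0\ \forall h\ge1\}$. $|\sigma|$ is the length of $\sigma$, $\sigma|_k$ its initial segment of length $k$, and $\sigma\ast\omega$ is concatenation (defined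 when the last letter of $\sigma$ and the first letter of $\omega$ form a word in $G_2$; any word may follow $\theta$). Fractal. $|A|$ denotes the diameter of $A$. Let $J_i$, $i\in G_1$, be non-empty compact subsets of $\mathbb{R}^q$ with $J_i=\overline{{\rm int}(J_i)}$. Let $c_{ij}\in(0,1)$ for $(i,j)\in G_2$. Inductively, for $\sigma\in G_k$, $k\ge1$, the sets $J_{\sigma\ast j}$, $\sigma\ast j\in G_{k+1}$, are non-overlapping subsets of $J_\sigma$, with $J_{\sigma\ast j}$ geometrically similar to $J_j$ and $|J_{\sigma\ast j}|/|J_j|=c_{\sigma_1\sigma_2}\cdots c_{\sigma_{k-1}\sigma_k}c_{\sigma_kj}$. Set $E:=\bigcap_{k\ge1}\bigcup_{\sigma\in G_k}J_\sigma$. (SEP): there is a constant $0<t<1$ such that for every $\sigma\in G^*$ (including $\sigma=\theta$, where $J_{\theta\ast j}=J_j$) and all distinct $j_1,j_2\in G_1$ with $\sigma\ast j_1,\sigma\ast j_2\in G^*$, $d(J_{\sigma\ast j_1},J_{\sigma\ast j_2})\ge t\max\{|J_{\sigma\ast j_1}|,|J_{\sigma\ast j_2}|\}$. Measure. Let $(q_i)_{i=1}^N$ be a probability vector with all $q_i>0$. Let $\widetilde\mu$ be the unique Borel probability measure on $G_\infty$ giving the set of sequences with initial segment $\sigma\in G_k$ the mass $q_{\sigma_1}p_{\sigma_1\sigma_2}\cdots p_{\sigma_{k-1}\sigma_k}$, $k\geq 1$. Under (SEP), $g:G_\infty\to E$, with $g(\sigma)$ the unique point of $\bigcap_{k\ge1}J_{\sigma|_k}$,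 is a bijection, and $\mu:=\widetilde\mu\circ g^{-1}$; thus $\mu(J_\sigma)=q_{\sigma_1}p_{\sigma_1\sigma_2}\cdots p_{\sigma_{k-1}\sigma_k}$ for $\sigma\in G_k$, $k\ge1$. *)

theory Defs
  imports "HOL-Probability.Probability"
begin

section \<open>Metric notions for an arbitrary norm\<close>

text \<open>
  The metric of the ambient space comes from an arbitrary norm \<open>nrm\<close> on \<open>real^'d\<close>, so the library
  constants \<^const>\<open>dist\<close>, \<^const>\<open>diameter\<close> and \<^const>\<open>setdist\<close>, which are tied to the Euclidean
  norm, are restated for \<open>nrm\<close>. All norms on \<open>real^'d\<close> give the same topology and Borel sets; for
  these the library notions are used.
\<close>

definition is_norm :: "(real^'d \<Rightarrow> real) \<Rightarrow> bool" where
  "is_norm nrm \<longleftrightarrow>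
     (\<forall>x. nrm x \<ge> 0) \<and>
     (\<forall>x. nrm x = 0 \<longleftrightarrow> x = 0) \<and>
     (\<forall>a x. nrm (a *\<^sub>R x) = \<bar>a\<bar> * nrm x) \<and>
     (\<forall>x y. nrm (x + y) \<le> nrm x + nrm y)"

definition ndist :: "(real^'d \<Rightarrow> real) \<Rightarrow> real^'d \<Rightarrow> real^'d \<Rightarrow> real" where
  "ndist nrm x y = nrm (x - y)"

definition ndiameter :: "(real^'d \<Rightarrow> real) \<Rightarrow> (real^'d) set \<Rightarrow> real" where
  "ndiameter nrm A = (if A = {} then 0 else SUP (x, y)\<in>A \<times> A. ndist nrm x y)"

definition nsetdist :: "(real^'d \<Rightarrow> real) \<Rightarrow> (real^'d) set \<Rightarrow> (real^'d) set \<Rightarrow> real" where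
  "nsetdist nrm A B =
     (if A = {} \<or> B = {} then 0 else Inf {ndist nrm x y | x y. x \<in> A \<and> y \<in> B})"

definition ninfdist :: "(real^'d \<Rightarrow> real) \<Rightarrow> real^'d \<Rightarrow> (real^'d) set \<Rightarrow> real" where
  "ninfdist nrm x A = (if A = {} then 0 else INF a\<in>A. ndist nrm x a)"

definition geom_similar :: "(real^'d \<Rightarrow> real) \<Rightarrow> (real^'d) set \<Rightarrow> (real^'d) set \<Rightarrow> bool" where
  "geom_similar nrm A B \<longleftrightarrow>
     (\<exists>(f :: real^'d \<Rightarrow> real^'d) r. r > 0 \<and>
        (\<forall>x y. ndist nrm (f x) (f y) = r * ndist nrm x y) \<and> f ` B = A)"


section \<open>Geometric mean quantization error\<close>

text \<open>Logarithm and exponential with \<open>log 0 = -\<infinity>\<close> and \<open>exp (-\<infinity>) = 0\<close>; note that \<open>ln 0 = 0\<close> in HOL.\<close>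

definition elog :: "ereal \<Rightarrow> ereal" where
  "elog x = (if x \<le> 0 then -\<infinity> else if x = \<infinity> then \<infinity> else ereal (ln (real_of_ereal x)))"

definition eexp :: "ereal \<Rightarrow> ereal" where
  "eexp x = (if x = -\<infinity> then 0 else if x = \<infinity> then \<infinity> else ereal (exp (real_of_ereal x)))"

text \<open>
  Integral of an extended real-valued function as integral of the positive part minus integral of
  the negative part (\<^const>\<open>e2ennreal\<close> truncates negative values to \<open>0\<close>). Unlike the Bochner
  integral, it gives \<open>-\<infinity>\<close> where the negative part alone diverges. The undetermined case
  \<open>\<infinity> - \<infinity>\<close> evaluates to \<open>\<infinity>\<close>; it cannot occur for the logarithmic distance to a finite set and
  a compactly supported probability measure.
\<close>

definition ereal_integral :: "'a measure \<Rightarrow> ('a \<Rightarrow> ereal) \<Rightarrow> ereal" where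
  "ereal_integral M f =
     enn2ereal (\<integral>\<^sup>+ x. e2ennreal (f x) \<partial>M) - enn2ereal (\<integral>\<^sup>+ x. e2ennreal (- f x) \<partial>M)"

definition geo_mean_error :: "(real^'d \<Rightarrow> real) \<Rightarrow> (real^'d) measure \<Rightarrow> nat \<Rightarrow> ereal" where
  "geo_mean_error nrm \<nu> n =
     (INF \<alpha>\<in>{\<alpha>. finite \<alpha> \<and> 1 \<le> card \<alpha> \<and> card \<alpha> \<le> n}.
        eexp (ereal_integral \<nu> (\<lambda>x. elog (ereal (ninfdist nrm x \<alpha>)))))"

definition upper_quant_coeff :: "(real^'d \<Rightarrow> real) \<Rightarrow> real \<Rightarrow> (real^'d) measure \<Rightarrow> ereal" where
  "upper_quant_coeff nrm s \<nu> =
     limsup (\<lambda>n. ereal (real n powr (1 / s)) * geo_mean_error nrm \<nu> n)"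

definition lower_quant_coeff :: "(real^'d \<Rightarrow> real) \<Rightarrow> real \<Rightarrow> (real^'d) measure \<Rightarrow> ereal" where
  "lower_quant_coeff nrm s \<nu> =
     liminf (\<lambda>n. ereal (real n powr (1 / s)) * geo_mean_error nrm \<nu> n)"

definition upper_quant_dim :: "(real^'d \<Rightarrow> real) \<Rightarrow> (real^'d) measure \<Rightarrow> ereal" where
  "upper_quant_dim nrm \<nu> =
     limsup (\<lambda>n. ereal (ln (real n)) / (- elog (geo_mean_error nrm \<nu> n)))"

definition lower_quant_dim :: "(real^'d \<Rightarrow> real) \<Rightarrow> (real^'d) measure \<Rightarrow> ereal" where
  "lower_quant_dim nrm \<nu> =
     liminf (\<lambda>n. ereal (ln (real n)) / (- elog (geo_mean_error nrm \<nu> n)))"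

text \<open>\<open>D\<^sub>0(\<nu>)\<close> exists and equals \<open>D\<close>.\<close>

definition has_quant_dim :: "(real^'d \<Rightarrow> real) \<Rightarrow> (real^'d) measure \<Rightarrow> ereal \<Rightarrow> bool" where
  "has_quant_dim nrm \<nu> D \<longleftrightarrow> lower_quant_dim nrm \<nu> = D \<and> upper_quant_dim nrm \<nu> = D"


section \<open>Matrices and words\<close>

text \<open>The alphabet \<open>{1,\<dots>,N}\<close> is a finite type \<open>'n\<close> with \<open>N = CARD('n)\<close>.\<close>

definition row_stochastic :: "real^'n^'n \<Rightarrow> bool" where
  "row_stochastic P \<longleftrightarrow> (\<forall>i j. P $ i $ j \<ge> 0) \<and> (\<forall>i. (\<Sum>j\<in>UNIV. P $ i $ j) = 1)"

definition mat_power :: "real^'n^'n \<Rightarrow> nat \<Rightarrow> real^'n^'n" where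
  "mat_power P k = (((**) P) ^^ k) (mat 1)"

text \<open>Irreducibility of an entrywise nonnegative matrix.\<close>

definition irreducible_matrix :: "real^'n^'n \<Rightarrow> bool" where
  "irreducible_matrix P \<longleftrightarrow> (\<forall>i j. \<exists>k\<ge>1. mat_power P k $ i $ j > 0)"

text \<open>
  The product \<open>A\<^bsub>\<sigma>1\<sigma>2\<^esub> \<cdots> A\<^bsub>\<sigma>(k-1)\<sigma>k\<^esub>\<close>; it is empty, hence \<open>1\<close>, for words of length at most \<open>1\<close>.
\<close>

definition word_prod :: "real^'n^'n \<Rightarrow> 'n list \<Rightarrow> real" where
  "word_prod A \<sigma> = (\<Prod>h<length \<sigma> - 1. A $ (\<sigma> ! h) $ (\<sigma> ! Suc h))"

definition words :: "real^'n^'n \<Rightarrow> nat \<Rightarrow> 'n list set" where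
  "words P k = {\<sigma>. length \<sigma> = k \<and> word_prod P \<sigma> > 0}"

definition all_words :: "real^'n^'n \<Rightarrow> 'n list set" where
  "all_words P = (\<Union>k. words P k)"

text \<open>Infinite sequences are indexed from \<open>0\<close>, so \<open>\<omega>|\<^sub>k\<close> lists \<open>\<omega> 0, \<dots>, \<omega> (k - 1)\<close>.\<close>

definition inf_words :: "real^'n^'n \<Rightarrow> (nat \<Rightarrow> 'n) set" where
  "inf_words P = {\<omega>. \<forall>h. P $ (\<omega> h) $ (\<omega> (Suc h)) > 0}"

definition init_seg :: "(nat \<Rightarrow> 'n) \<Rightarrow> nat \<Rightarrow> 'n list" where
  "init_seg \<omega> k = map \<omega> [0..<k]"


section \<open>Mauldin--Williams fractals\<close>

text \<open>
  \<open>J [i]\<close> is the initial set \<open>J\<^sub>i\<close>. Only the values of \<open>J\<close> at nonempty admissible words and the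
  entries \<open>c $ i $ j\<close> with \<open>[i, j] \<in> words P 2\<close> matter.
\<close>

definition mauldin_williams ::
  "(real^'d \<Rightarrow> real) \<Rightarrow> real^'n^'n \<Rightarrow> real^'n^'n \<Rightarrow> ('n list \<Rightarrow> (real^'d) set) \<Rightarrow> bool" where
  "mauldin_williams nrm P c J \<longleftrightarrow>
     (\<forall>i. J [i] \<noteq> {} \<and> compact (J [i]) \<and> J [i] = closure (interior (J [i]))) \<and>
     (\<forall>i j. [i, j] \<in> words P 2 \<longrightarrow> 0 < c $ i $ j \<and> c $ i $ j < 1) \<and>
     (\<forall>k\<ge>1. \<forall>\<sigma>\<in>words P k.
        (\<forall>j. \<sigma> @ [j] \<in> words P (k + 1) \<longrightarrow>
           J (\<sigma> @ [j]) \<subseteq> J \<sigma> \<and>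
           geom_similar nrm (J (\<sigma> @ [j])) (J [j]) \<and>
           ndiameter nrm (J (\<sigma> @ [j])) / ndiameter nrm (J [j]) = word_prod c (\<sigma> @ [j])) \<and>
        (\<forall>j1 j2. j1 \<noteq> j2 \<and> \<sigma> @ [j1] \<in> words P (k + 1) \<and> \<sigma> @ [j2] \<in> words P (k + 1) \<longrightarrow>
           interior (J (\<sigma> @ [j1])) \<inter> interior (J (\<sigma> @ [j2])) = {}))"

definition mw_fractal :: "real^'n^'n \<Rightarrow> ('n list \<Rightarrow> (real^'d) set) \<Rightarrow> (real^'d) set" where
  "mw_fractal P J = (\<Inter>k\<in>{1..}. \<Union>\<sigma>\<in>words P k. J \<sigma>)"

definition separation_property ::
  "(real^'d \<Rightarrow> real) \<Rightarrow> real^'n^'n \<Rightarrow> ('n list \<Rightarrow> (real^'d) set) \<Rightarrow> bool" where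
  "separation_property nrm P J \<longleftrightarrow>
     (\<exists>t. 0 < t \<and> t < 1 \<and>
        (\<forall>\<sigma>\<in>all_words P. \<forall>j1 j2.
           j1 \<noteq> j2 \<and> \<sigma> @ [j1] \<in> all_words P \<and> \<sigma> @ [j2] \<in> all_words P \<longrightarrow>
             nsetdist nrm (J (\<sigma> @ [j1])) (J (\<sigma> @ [j2]))
               \<ge> t * max (ndiameter nrm (J (\<sigma> @ [j1]))) (ndiameter nrm (J (\<sigma> @ [j2])))))"


section \<open>Markov-type measures\<close>

text \<open>
  The Borel sets of the sequence space are the trace of the product of the discrete
  \<open>\<sigma>\<close>-algebras.
\<close>

definition markov_measure ::
  "real^'n^'n \<Rightarrow> real^'n \<Rightarrow> (nat \<Rightarrow> 'n) measure \<Rightarrow> bool" where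
  "markov_measure P q M \<longleftrightarrow>
     prob_space M \<and>
     sets M = sets (restrict_space (Pi\<^sub>M UNIV (\<lambda>_. count_space UNIV)) (inf_words P)) \<and>
     (\<forall>k\<ge>1. \<forall>\<sigma>\<in>words P k.
        measure M {\<omega> \<in> inf_words P. init_seg \<omega> k = \<sigma>} = q $ (hd \<sigma>) * word_prod P \<sigma>)"

text \<open>The coding map \<open>g\<close>; on \<^term>\<open>inf_words P\<close> its values lie in \<^term>\<open>mw_fractal P J\<close>.\<close>

definition coding_map :: "('n list \<Rightarrow> (real^'d) set) \<Rightarrow> (nat \<Rightarrow> 'n) \<Rightarrow> real^'d" where
  "coding_map J \<omega> = (THE x. x \<in> (\<Inter>k\<in>{1..}. J (init_seg \<omega> k)))"

lemma init_seg_in_words: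
  assumes "\<omega> \<in> inf_words P"
  shows "init_seg \<omega> k \<in> words P k"
  using assms by (auto simp: init_seg_def words_def word_prod_def inf_words_def intro!: prod_pos)

lemma coding_map_in_fractal:
  assumes "\<omega> \<in> inf_words P" and "\<exists>!x. x \<in> (\<Inter>k\<in>{1..}. J (init_seg \<omega> k))"
  shows "coding_map J \<omega> \<in> mw_fractal P J"
proof -
  have "coding_map J \<omega> \<in> (\<Inter>k\<in>{1..}. J (init_seg \<omega> k))"
    unfolding coding_map_def by (rule theI') (rule assms(2))
  then show ?thesis
    using init_seg_in_words[OF assms(1)] by (fastforce simp: mw_fractal_def)
qed

definition markov_type_measure ::
  "('n list \<Rightarrow> (real^'d) set) \<Rightarrow> (nat \<Rightarrow> 'n) measure \<Rightarrow> (real^'d) measure" where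
  "markov_type_measure J M = distr M borel (coding_map J)"

text \<open>\<open>s\<^sub>0\<close>, where \<open>v\<close> is the positive normalized left eigenvector of \<open>P\<close>.\<close>

definition entropy_exponent :: "real^'n^'n \<Rightarrow> real^'n^'n \<Rightarrow> real^'n \<Rightarrow> real" where
  "entropy_exponent P c v =
     (\<Sum>i\<in>UNIV. v $ i * (\<Sum>j | [i, j] \<in> words P 2. P $ i $ j * ln (P $ i $ j))) /
     (\<Sum>i\<in>UNIV. v $ i * (\<Sum>j | [i, j] \<in> words P 2. P $ i $ j * ln (c $ i $ j)))"

end

theory Submission
  imports Defs
begin

text \<open>
  Pull everything back to the sequence space. Stop a sequence \<open>\<omega>\<close> at the first level \<open>T\<close> at which
  the mass of its initial segment drops below \<open>\<epsilon>\<close>; the stopped words form a finite antichain of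
  cylinders of mass comparable to \<open>\<epsilon>\<close>. The exponent \<open>s\<^sub>0\<close> is chosen so that
  \<open>f i j = ln c\<^sub>i\<^sub>j - ln p\<^sub>i\<^sub>j / s\<^sub>0\<close> has mean zero under the stationary chain, so by a solution of the
  Poisson equation the sums of \<open>f\<close> along \<open>\<omega>\<close> differ from a martingale by a bounded amount. Optional
  stopping then shows that the mean of the logarithmic diameter of the stopped cylinder is
  \<open>ln \<epsilon> / s\<^sub>0\<close> up to a bounded error.

  Upper bound: with \<open>\<epsilon>\<close> of order \<open>1/n\<close> there are at most \<open>n\<close> stopped words, and one point in each
  of their sets is a good choice of \<open>\<alpha>\<close>. Lower bound: with \<open>\<epsilon> = 1/n\<close>, by separation a point \<open>a\<close> is
  close, relative to the diameter at level \<open>T + k\<close>, only to points of a single cylinder, whose mass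
  is at most \<open>\<epsilon> r^k\<close>. So each of the \<open>n\<close> points of \<open>\<alpha>\<close> lowers the mean logarithmic distance by
  \<open>O(\<epsilon>)\<close> only.
\<close>

section \<open>Arbitrary norms\<close>

lemma is_norm_sum_le:
  assumes "is_norm nrm" shows "nrm (sum f S) \<le> (\<Sum>i\<in>S. nrm (f i))"
proof -
  have z: "nrm 0 = 0" and tr: "\<And>x y. nrm (x + y) \<le> nrm x + nrm y"
    using assms by (auto simp: is_norm_def)
  show ?thesis
  proof (induction S rule: infinite_finite_induct)
    case (insert a S)
    then show ?case using tr[of "f a" "sum f S"] by simp
  qed (simp_all add: z)
qed

lemma is_norm_le_norm:
  fixes nrm :: "real^'d \<Rightarrow> real"
  assumes "is_norm nrm" shows "\<exists>K>0. \<forall>x. nrm x \<le> K * norm x"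
proof -
  define K where "K = 1 + (\<Sum>b\<in>Basis. nrm b)"
  have nn: "\<And>x. nrm x \<ge> 0" and sc: "\<And>a x. nrm (a *\<^sub>R x) = \<bar>a\<bar> * nrm x"
    using assms by (auto simp: is_norm_def)
  have "K > 0" unfolding K_def using nn by (smt (verit) sum_nonneg)
  moreover have "nrm x \<le> K * norm x" for x
  proof -
    have "nrm x = nrm (\<Sum>b\<in>Basis. (x \<bullet> b) *\<^sub>R b)" by (simp add: euclidean_representation)
    also have "\<dots> \<le> (\<Sum>b\<in>Basis. nrm ((x \<bullet> b) *\<^sub>R b))" by (rule is_norm_sum_le[OF assms])
    also have "\<dots> \<le> (\<Sum>b\<in>Basis. norm x * nrm b)"
      by (rule sum_mono) (simp add: sc nn mult_right_mono Basis_le_norm)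
    also have "\<dots> \<le> K * norm x" by (simp add: K_def sum_distrib_left algebra_simps)
    finally show ?thesis .
  qed
  ultimately show ?thesis by blast
qed

lemma is_norm_minus: "is_norm nrm \<Longrightarrow> nrm (- x) = nrm x"
  unfolding is_norm_def by (metis abs_minus_cancel abs_one mult_1 scaleR_minus1_left)

lemma ndist_nonneg: "is_norm nrm \<Longrightarrow> 0 \<le> ndist nrm x y"
  by (simp add: ndist_def is_norm_def)

lemma ndist_commute: "is_norm nrm \<Longrightarrow> ndist nrm x y = ndist nrm y x"
  unfolding ndist_def by (metis is_norm_minus minus_diff_eq)

lemma ndist_triangle: "is_norm nrm \<Longrightarrow> ndist nrm x z \<le> ndist nrm x y + ndist nrm y z"
  unfolding ndist_def is_norm_def by (metis diff_add_cancel add_diff_eq)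

lemma is_norm_continuous_on:
  fixes nrm :: "real^'d \<Rightarrow> real"
  assumes "is_norm nrm" shows "continuous_on S nrm"
proof -
  obtain K where K: "K > 0" "\<And>x. nrm x \<le> K * norm x" using is_norm_le_norm[OF assms] by blast
  have d: "\<bar>nrm x - nrm y\<bar> \<le> K * norm (x - y)" for x y
  proof -
    have "nrm x \<le> nrm (x - y) + nrm y" "nrm y \<le> nrm (y - x) + nrm x"
      using assms unfolding is_norm_def by (metis diff_add_cancel)+
    moreover have "nrm (y - x) = nrm (x - y)" using is_norm_minus[OF assms, of "x - y"] by simp
    ultimately show ?thesis using K(2)[of "x - y"] by linarith
  qed
  have "K-lipschitz_on S nrm"
    using d K(1) by (auto simp: lipschitz_on_def dist_norm)
  then show ?thesis by (rule lipschitz_on_continuous_on)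
qed

text \<open>By continuity \<open>nrm\<close> attains a minimum on the compact Euclidean unit sphere,
  and the minimum is positive because \<open>nrm\<close> vanishes only at 0. Homogeneity carries the
  bound to all vectors.\<close>

lemma norm_le_is_norm:
  fixes nrm :: "real^'d \<Rightarrow> real"
  assumes "is_norm nrm" shows "\<exists>K>0. \<forall>x. norm x \<le> K * nrm x"
proof -
  have nn: "\<And>x. nrm x \<ge> 0" and sc: "\<And>a x. nrm (a *\<^sub>R x) = \<bar>a\<bar> * nrm x"
    and z: "\<And>x. nrm x = 0 \<longleftrightarrow> x = 0"
    using assms by (auto simp: is_norm_def)
  have "axis undefined 1 \<in> (sphere 0 1 :: (real^'d) set)" by (simp add: norm_axis_1)
  then obtain u where u: "u \<in> sphere 0 1" "\<And>y. y \<in> (sphere 0 1 :: (real^'d) set) \<Longrightarrow> nrm u \<le> nrm y"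
    using continuous_attains_inf[OF compact_sphere _ is_norm_continuous_on[OF assms]] by (metis empty_iff)
  have p: "nrm u > 0" using u(1) z[of u] nn[of u] by auto
  have "norm x \<le> (1 / nrm u) * nrm x" for x
  proof (cases "x = 0")
    case False
    then have "nrm u \<le> nrm ((1 / norm x) *\<^sub>R x)" by (intro u(2)) simp
    also have "\<dots> = nrm x / norm x" by (simp add: sc)
    finally show ?thesis using False p by (simp add: field_simps)
  qed (use nn p in simp)
  then show ?thesis using p by (metis zero_less_divide_1_iff)
qed

lemma ninfdist_Min:
  assumes "finite \<alpha>" "\<alpha> \<noteq> {}"
  shows "ninfdist nrm x \<alpha> = Min (ndist nrm x ` \<alpha>)"
  using assms by (simp add: ninfdist_def cInf_eq_Min)

lemma borel_measurable_ninfdist: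
  fixes nrm :: "real^'d \<Rightarrow> real"
  assumes "is_norm nrm" "finite \<alpha>" "\<alpha> \<noteq> {}"
  shows "(\<lambda>x. ninfdist nrm x \<alpha>) \<in> borel_measurable borel"
proof -
  have "(\<lambda>x. ndist nrm x a) \<in> borel_measurable borel" for a
    unfolding ndist_def
    by (intro borel_measurable_continuous_onI continuous_on_compose2[OF is_norm_continuous_on[OF assms(1)]]
        continuous_intros) auto
  then have "(\<lambda>x. Min ((\<lambda>a. ndist nrm x a) ` \<alpha>)) \<in> borel_measurable borel"
    using assms by (intro borel_measurable_Min) auto
  then show ?thesis by (simp add: ninfdist_Min[OF assms(2,3)])
qed

section \<open>The Poisson equation of an irreducible stochastic matrix\<close>

lemma left_fixed_mat_power:
  fixes P :: "real^'n^'n"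
  assumes "u v* P = u" shows "u v* mat_power P k = u"
proof (induction k)
  case (Suc k)
  have "u v* mat_power P (Suc k) = (u v* P) v* mat_power P k"
    by (simp add: mat_power_def vector_matrix_mul_assoc)
  then show ?case using Suc assms by simp
qed (simp add: mat_power_def)

lemma mat_power_nonneg:
  fixes P :: "real^'n^'n"
  assumes "\<And>i j. P $ i $ j \<ge> 0" shows "mat_power P k $ i $ j \<ge> 0"
proof (induction k arbitrary: i j)
  case (Suc k)
  have "mat_power P (Suc k) $ i $ j = (\<Sum>l\<in>UNIV. P $ i $ l * mat_power P k $ l $ j)"
    by (simp add: mat_power_def matrix_matrix_mult_def)
  then show ?case using Suc assms by (simp add: sum_nonneg)
qed (simp add: mat_power_def mat_def)

text \<open>Perron-Frobenius argument: subtract from \<open>w\<close> the largest multiple of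
  \<open>v\<close> that leaves a nonnegative vector \<open>u\<close>. Then \<open>u\<close> is fixed
  by \<open>P\<close> and vanishes in some coordinate \<open>i\<close>. A power of \<open>P\<close>
  with positive entry \<open>(j, i)\<close> carries any mass of \<open>u\<close> at \<open>j\<close>
  to \<open>i\<close>, so irreducibility forces \<open>u = 0\<close>.\<close>

lemma left_eigenvector_unique:
  fixes P :: "real^'n^'n"
  assumes "\<And>i j. P $ i $ j \<ge> 0" "irreducible_matrix P"
    and v: "\<And>i. v $ i > 0" "v v* P = v" and w: "w v* P = w"
  shows "\<exists>l. w = l *\<^sub>R v"
proof -
  define l where "l = Min (range (\<lambda>i. w $ i / v $ i))"
  have le: "l \<le> w $ i / v $ i" for i unfolding l_def by simp
  have "l \<in> range (\<lambda>i. w $ i / v $ i)" unfolding l_def by (rule Min_in) auto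
  then obtain i where i: "l = w $ i / v $ i" by blast
  define u where "u = w - l *\<^sub>R v"
  have u0: "u $ j \<ge> 0" for j
    using le[of j] v(1)[of j] by (simp add: u_def field_simps)
  have ui: "u $ i = 0" using i v(1)[of i] by (simp add: u_def)
  have up: "u v* P = u"
    by (simp add: u_def vector_matrix_mult_diff_distrib v(2) w scaleR_vector_matrix_assoc)
  have "u $ j = 0" for j
  proof -
    obtain k where k: "mat_power P k $ j $ i > 0" using assms(2) unfolding irreducible_matrix_def by blast
    have "(\<Sum>j\<in>UNIV. u $ j * mat_power P k $ j $ i) = u $ i"
      using left_fixed_mat_power[OF up, of k] by (simp add: vector_matrix_mult_def vec_eq_iff mult.commute)
    then have "\<forall>j\<in>UNIV. u $ j * mat_power P k $ j $ i = 0"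
      using ui by (subst sum_nonneg_eq_0_iff[symmetric]) (auto intro!: mult_nonneg_nonneg u0 mat_power_nonneg assms(1))
    then show ?thesis using k by (metis UNIV_I less_irrefl mult_eq_0_iff)
  qed
  then show ?thesis by (intro exI[of _ l]) (simp add: u_def vec_eq_iff)
qed

text \<open>The orthogonal complement of the range of \<open>I - P\<close> consists of the left fixed vectors of \<open>P\<close>,
  i.e. of the multiples of \<open>v\<close>.\<close>

lemma poisson_equation:
  fixes P :: "real^'n^'n"
  assumes "\<And>i j. P $ i $ j \<ge> 0" "irreducible_matrix P"
    and v: "\<And>i. v $ i > 0" "v v* P = v" and F: "v \<bullet> F = 0"
  shows "\<exists>h. h = F + P *v h"
proof -
  define S where "S = range (\<lambda>h. h - P *v h)"
  have "linear (\<lambda>h. h - P *v h)"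
    by (auto intro!: linearI simp: matrix_vector_right_distrib matrix_vector_mult_scaleR scaleR_diff_right)
  then have sub: "span S = S"
    unfolding S_def by (metis linear_subspace_image span_eq_iff subspace_UNIV)
  obtain y z where yz: "y \<in> S" "\<And>w. w \<in> S \<Longrightarrow> orthogonal z w" "F = y + z"
    using orthogonal_subspace_decomp_exists[of S F] unfolding sub by metis
  have adj: "(u v* P) \<bullet> x = u \<bullet> (P *v x)" for u x
    by (simp add: dot_lmul_matrix)
  have "(z - z v* P) \<bullet> x = 0" for x
    using yz(2)[of "x - P *v x"] by (auto simp: S_def orthogonal_def inner_diff adj)
  then have "z v* P = z" by (metis inner_eq_zero_iff eq_iff_diff_eq_0)
  then obtain l where l: "z = l *\<^sub>R v" using left_eigenvector_unique[OF assms(1,2) v] by blast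
  obtain h where h: "y = h - P *v h" using yz(1) by (auto simp: S_def)
  \<comment> \<open>The vector \<open>v\<close> is orthogonal to the range of \<open>I - P\<close>
    and to \<open>F\<close>, hence to \<open>z\<close>. Since \<open>z\<close> is a multiple of
    \<open>v\<close>, it must vanish, and \<open>F\<close> itself lies in the range.\<close>
  have "v \<bullet> y = 0" using adj[of v h] by (simp add: h inner_diff v(2))
  then have "v \<bullet> z = 0" using F by (simp add: yz(3) inner_add)
  then have "z = 0" using l by auto
  then show ?thesis using h yz(3) by (intro exI[of _ h]) simp
qed

section \<open>Optional stopping for the Markov measure\<close>

lemma word_prod_single [simp]: "word_prod A [i] = 1"
  by (simp add: word_prod_def)

lemma word_prod_snoc:
  assumes "\<sigma> \<noteq> []" shows "word_prod A (\<sigma> @ [j]) = word_prod A \<sigma> * A $ last \<sigma> $ j"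
proof -
  obtain n where n: "length \<sigma> = Suc n" using assms by (cases "length \<sigma>") auto
  have "word_prod A (\<sigma> @ [j]) = (\<Prod>h<n. A $ ((\<sigma> @ [j]) ! h) $ ((\<sigma> @ [j]) ! Suc h)) * A $ ((\<sigma> @ [j]) ! n) $ ((\<sigma> @ [j]) ! Suc n)"
    by (simp add: word_prod_def n)
  moreover have "(\<Prod>h<n. A $ ((\<sigma> @ [j]) ! h) $ ((\<sigma> @ [j]) ! Suc h)) = word_prod A \<sigma>"
    by (simp add: word_prod_def n nth_append)
  moreover have "(\<sigma> @ [j]) ! n = last \<sigma>" "(\<sigma> @ [j]) ! Suc n = j"
    using n assms by (simp_all add: nth_append last_conv_nth)
  ultimately show ?thesis by simp
qed

lemma init_seg_Suc: "init_seg \<omega> (Suc k) = init_seg \<omega> k @ [\<omega> k]"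
  by (simp add: init_seg_def)

lemma init_seg_Suc_neq_Nil [simp]: "init_seg \<omega> (Suc k) \<noteq> []"
  by (simp add: init_seg_Suc)

lemma last_init_seg [simp]: "last (init_seg \<omega> (Suc k)) = \<omega> k"
  by (simp add: init_seg_Suc)

lemma hd_init_seg [simp]: "hd (init_seg \<omega> (Suc k)) = \<omega> 0"
  by (simp add: init_seg_def hd_map del: upt_Suc)

lemma length_init_seg [simp]: "length (init_seg \<omega> k) = k"
  by (simp add: init_seg_def)

lemma init_seg_one [simp]: "init_seg \<omega> (Suc 0) = [\<omega> 0]"
  by (simp add: init_seg_def)

lemma init_seg_eq_iff: "init_seg \<omega> k = init_seg \<omega>' k \<longleftrightarrow> (\<forall>i<k. \<omega> i = \<omega>' i)"
  by (auto simp: init_seg_def)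

lemma word_prod_init_seg_Suc:
  "word_prod A (init_seg \<omega> (Suc (Suc k))) = word_prod A (init_seg \<omega> (Suc k)) * A $ \<omega> k $ \<omega> (Suc k)"
  by (subst init_seg_Suc, subst word_prod_snoc) simp_all

lemma word_prod_init_seg: "word_prod A (init_seg \<omega> (Suc k)) = (\<Prod>l<k. A $ \<omega> l $ \<omega> (Suc l))"
  by (induction k) (simp_all add: word_prod_init_seg_Suc)

lemma finite_words: "finite (words P k :: 'n::finite list set)"
  by (rule finite_subset[OF _ finite_lists_length_eq[of UNIV k]]) (auto simp: words_def)

lemma two_in_words [simp]: "[i, j] \<in> words P 2 \<longleftrightarrow> P $ i $ j > 0"
  by (simp add: words_def word_prod_def)

lemma finite_pos_lower_bound:
  fixes f :: "'a \<Rightarrow> real"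
  assumes "finite S" "\<And>x. x \<in> S \<Longrightarrow> f x > 0"
  obtains b where "0 < b" "b < 1" "\<And>x. x \<in> S \<Longrightarrow> b \<le> f x"
proof
  \<comment> \<open>The extra element 1/2 keeps the set nonempty when \<open>S\<close> is empty and
    forces the bound below 1.\<close>
  let ?b = "Min (insert (1/2) (f ` S))"
  show "0 < ?b" "?b < 1" using assms by (auto simp: Min_less_iff)
  show "\<And>x. x \<in> S \<Longrightarrow> ?b \<le> f x" using assms(1) by simp
qed

lemma finite_upper_bound_less_1:
  fixes f :: "'a \<Rightarrow> real"
  assumes "finite S" "\<And>x. x \<in> S \<Longrightarrow> f x < 1"
  obtains b where "0 < b" "b < 1" "\<And>x. x \<in> S \<Longrightarrow> f x \<le> b"
proof
  let ?b = "Max (insert (1/2) (f ` S))"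
  show "?b < 1" using assms by auto
  show "0 < ?b" using assms(1) by (subst Max_gr_iff) auto
  show "\<And>x. x \<in> S \<Longrightarrow> f x \<le> ?b" using assms(1) by simp
qed

section \<open>The Markov measure, cylinders and prefix functions\<close>

locale markov_words =
  fixes P :: "real^'n^'n" and q :: "real^'n" and M :: "(nat \<Rightarrow> 'n) measure"
  assumes stoch: "row_stochastic P"
    and q_pos: "\<And>i. q $ i > 0"
    and markov: "markov_measure P q M"
    and branching: "\<And>i. card {j. P $ i $ j > 0} \<ge> 2"
begin

sublocale prob_space M using markov by (simp add: markov_measure_def)

lemma space_M: "space M = inf_words P"
proof -
  have "sets M = sets (restrict_space (Pi\<^sub>M UNIV (\<lambda>_. count_space UNIV)) (inf_words P))"
    using markov by (simp add: markov_measure_def)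
  from sets_eq_imp_space_eq[OF this] show ?thesis
    by (simp add: space_restrict_space space_PiM PiE_def)
qed

lemma P_nonneg: "0 \<le> P $ i $ j" and P_row: "(\<Sum>j\<in>UNIV. P $ i $ j) = 1"
  using stoch by (auto simp: row_stochastic_def)

text \<open>A row with two positive entries and sum 1 has no entry equal to 1. This is how the
  branching hypothesis enters: every further letter strictly decreases the mass.\<close>

lemma P_less_1: "P $ i $ j < 1"
proof -
  have "\<not> {j. P $ i $ j > 0} \<subseteq> {j}"
    using branching[of i] card_mono[of "{j}" "{j. P $ i $ j > 0}"] by auto
  then obtain l where l: "P $ i $ l > 0" "l \<noteq> j" by auto
  have "P $ i $ j + P $ i $ l = (\<Sum>j\<in>{j, l}. P $ i $ j)" using l by simp
  also have "\<dots> \<le> 1" unfolding P_row[of i, symmetric] by (rule sum_mono2) (auto simp: P_nonneg)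
  finally show ?thesis using l by simp
qed

lemma P_inf_words: "\<omega> \<in> inf_words P \<Longrightarrow> 0 < P $ \<omega> k $ \<omega> (Suc k)"
  by (simp add: inf_words_def)

abbreviation mass :: "'n list \<Rightarrow> real" where
  "mass \<sigma> \<equiv> q $ hd \<sigma> * word_prod P \<sigma>"

lemma mass_Suc: "mass (init_seg \<omega> (Suc (Suc k))) = mass (init_seg \<omega> (Suc k)) * P $ \<omega> k $ \<omega> (Suc k)"
  by (simp add: word_prod_init_seg_Suc)

lemma mass_pos: "\<omega> \<in> inf_words P \<Longrightarrow> 0 < mass (init_seg \<omega> (Suc k))"
  by (simp add: word_prod_init_seg q_pos inf_words_def prod_pos)

lemma measurable_init_seg [measurable]: "(\<lambda>\<omega>. init_seg \<omega> k) \<in> measurable M (count_space UNIV)"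
proof -
  have pred: "Measurable.pred (Pi\<^sub>M UNIV (\<lambda>_. count_space UNIV)) (\<lambda>\<omega>. init_seg \<omega> k = \<sigma>)"
    for \<sigma> :: "'n list"
  proof -
    have "(\<lambda>\<omega>. init_seg \<omega> k = \<sigma>) = (\<lambda>\<omega>. length \<sigma> = k \<and> (\<forall>i\<in>{..<k}. \<omega> i = \<sigma> ! i))"
      by (auto simp: fun_eq_iff init_seg_def list_eq_iff_nth_eq)
    then show ?thesis by simp
  qed
  have "{x \<in> space (Pi\<^sub>M UNIV (\<lambda>_. count_space UNIV)). init_seg x k = \<sigma>} \<in> sets (Pi\<^sub>M UNIV (\<lambda>_. count_space UNIV))"
    for \<sigma> :: "'n list" using pred[of \<sigma>] by (simp only: pred_def)
  then have "(\<lambda>\<omega>. init_seg \<omega> k) \<in> measurable (Pi\<^sub>M UNIV (\<lambda>_. count_space UNIV)) (count_space (UNIV :: 'n list set))"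
    by (subst measurable_count_space_eq_countable)
       (auto simp: vimage_def Int_def conj_commute simp del: space_PiM)
  then have "(\<lambda>\<omega>. init_seg \<omega> k) \<in> measurable (restrict_space (Pi\<^sub>M UNIV (\<lambda>_. count_space UNIV)) (inf_words P)) (count_space UNIV)"
    by (rule measurable_restrict_space1)
  moreover have eq: "sets M = sets (restrict_space (Pi\<^sub>M UNIV (\<lambda>_. count_space UNIV)) (inf_words P))"
    using markov by (simp add: markov_measure_def)
  ultimately show ?thesis by (subst measurable_cong_sets[OF eq refl])
qed

abbreviation cyl :: "'n list \<Rightarrow> (nat \<Rightarrow> 'n) set" where
  "cyl \<sigma> \<equiv> {\<omega> \<in> inf_words P. init_seg \<omega> (length \<sigma>) = \<sigma>}"

lemma cyl_sets [measurable]: "cyl \<sigma> \<in> sets M"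
proof -
  have "cyl \<sigma> = (\<lambda>\<omega>. init_seg \<omega> (length \<sigma>)) -` {\<sigma>} \<inter> space M" by (auto simp: space_M)
  then show ?thesis using measurable_sets[OF measurable_init_seg] by simp
qed

lemma measure_cyl: "\<sigma> \<in> words P (Suc k) \<Longrightarrow> measure M (cyl \<sigma>) = mass \<sigma>"
  using markov by (auto simp: markov_measure_def words_def)

lemma integrable_prefix [simp]: "integrable M (\<lambda>\<omega>. \<phi> (init_seg \<omega> k) :: real)"
proof -
  have "finite ((\<lambda>\<omega>. \<phi> (init_seg \<omega> k)) ` space M)"
    by (rule finite_subset[OF _ finite_imageI[OF finite_words[of P k], of \<phi>]])
       (auto simp: space_M intro: init_seg_in_words)
  then obtain B where "\<And>x. x \<in> (\<lambda>\<omega>. \<phi> (init_seg \<omega> k)) ` space M \<Longrightarrow> \<bar>x\<bar> \<le> B"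
    by (metis finite_imp_bounded bounded_real)
  then show ?thesis by (intro integrable_const_bound[of _ B]) auto
qed

lemma integral_prefix:
  "(\<integral>\<omega>. \<phi> (init_seg \<omega> (Suc k)) \<partial>M) = (\<Sum>\<sigma>\<in>words P (Suc k). mass \<sigma> * \<phi> \<sigma>)" for \<phi> :: "'n list \<Rightarrow> real"
proof -
  have "(\<integral>\<omega>. \<phi> (init_seg \<omega> (Suc k)) \<partial>M)
      = (\<integral>\<omega>. (\<Sum>\<sigma>\<in>words P (Suc k). \<phi> \<sigma> * indicator (cyl \<sigma>) \<omega>) \<partial>M)"
  proof (rule Bochner_Integration.integral_cong[OF refl])
    fix \<omega> assume w: "\<omega> \<in> space M"
    have "(\<Sum>\<sigma>\<in>words P (Suc k). \<phi> \<sigma> * indicator (cyl \<sigma>) \<omega>)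
        = (\<Sum>\<sigma>\<in>words P (Suc k). if \<sigma> = init_seg \<omega> (Suc k) then \<phi> \<sigma> else 0)"
      using w by (intro sum.cong) (auto simp: space_M words_def indicator_def)
    then show "\<phi> (init_seg \<omega> (Suc k)) = (\<Sum>\<sigma>\<in>words P (Suc k). \<phi> \<sigma> * indicator (cyl \<sigma>) \<omega>)"
      using w init_seg_in_words[of \<omega> P "Suc k"] by (simp add: finite_words space_M)
  qed
  also have "\<dots> = (\<Sum>\<sigma>\<in>words P (Suc k). \<phi> \<sigma> * measure M (cyl \<sigma>))"
    by (subst Bochner_Integration.integral_sum) (auto simp: emeasure_eq_measure)
  finally show ?thesis by (simp add: measure_cyl mult.commute)
qed

lemma words_Suc: "words P (Suc (Suc k)) = (\<lambda>(\<sigma>, j). \<sigma> @ [j]) ` (SIGMA \<sigma>:words P (Suc k). {j. P $ last \<sigma> $ j > 0})"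
proof -
  have nn: "word_prod P \<sigma> \<ge> 0" for \<sigma> by (simp add: word_prod_def prod_nonneg P_nonneg)
  have "\<sigma> @ [j] \<in> words P (Suc (Suc k)) \<longleftrightarrow> \<sigma> \<in> words P (Suc k) \<and> P $ last \<sigma> $ j > 0" for \<sigma> j
  proof (cases "\<sigma> = []")
    case False
    then show ?thesis
      using nn[of \<sigma>] P_nonneg[of "last \<sigma>" j] by (auto simp: words_def word_prod_snoc zero_less_mult_iff)
  qed (simp add: words_def)
  moreover have "\<exists>\<sigma> j. \<tau> = \<sigma> @ [j]" if "\<tau> \<in> words P (Suc (Suc k))" for \<tau>
    using that by (cases \<tau> rule: rev_cases) (auto simp: words_def)
  ultimately show ?thesis by (auto simp: image_iff) (metis+)
qed

lemma snoc_in_words: "\<sigma> @ [j] \<in> words P (Suc (Suc k)) \<longleftrightarrow> \<sigma> \<in> words P (Suc k) \<and> P $ last \<sigma> $ j > 0"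
  unfolding words_Suc by (auto simp: image_iff)

lemma sum_words_Suc:
  "(\<Sum>\<tau>\<in>words P (Suc (Suc k)). g \<tau>) = (\<Sum>\<sigma>\<in>words P (Suc k). \<Sum>j | P $ last \<sigma> $ j > 0. g (\<sigma> @ [j]))"
  unfolding words_Suc
  by (subst sum.reindex) (auto simp: inj_on_def sum.Sigma finite_words case_prod_unfold)

lemma sum_row: "(\<Sum>j | P $ i $ j > 0. P $ i $ j * f j) = (\<Sum>j\<in>UNIV. P $ i $ j * f j)" for f :: "'n \<Rightarrow> real"
  by (rule sum.mono_neutral_left) (auto simp: not_less intro: antisym P_nonneg)

text \<open>The weight \<open>b\<close> sees only the letters up to position \<open>k\<close>, while
  the next letter is drawn from row \<open>\<omega> k\<close> of \<open>P\<close>. Summing over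
  one-letter extensions of a fixed prefix therefore produces the row mean of \<open>d\<close>, which
  is zero.\<close>

lemma integral_martingale_increment:
  assumes "\<And>i. (\<Sum>j\<in>UNIV. P $ i $ j * d i j) = 0"
  shows "(\<integral>\<omega>. b (init_seg \<omega> (Suc k)) * d (\<omega> k) (\<omega> (Suc k)) \<partial>M) = 0"
proof -
  \<comment> \<open>The integrand becomes a function of the prefix that is one letter longer, so
    that its integral is a finite sum over words.\<close>
  let ?\<phi> = "\<lambda>\<tau>. b (butlast \<tau>) * d (last (butlast \<tau>)) (last \<tau>)"
  have "(\<integral>\<omega>. b (init_seg \<omega> (Suc k)) * d (\<omega> k) (\<omega> (Suc k)) \<partial>M)
     = (\<integral>\<omega>. ?\<phi> (init_seg \<omega> (Suc (Suc k))) \<partial>M)"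
    by (simp add: init_seg_Suc[of _ "Suc k"])
  also have "\<dots> = (\<Sum>\<sigma>\<in>words P (Suc k). \<Sum>j | P $ last \<sigma> $ j > 0. mass (\<sigma> @ [j]) * (b \<sigma> * d (last \<sigma>) j))"
    unfolding integral_prefix[of ?\<phi>] sum_words_Suc by simp
  also have "\<dots> = (\<Sum>\<sigma>\<in>words P (Suc k). mass \<sigma> * b \<sigma> * (\<Sum>j | P $ last \<sigma> $ j > 0. P $ last \<sigma> $ j * d (last \<sigma>) j))"
    unfolding sum_distrib_left
  proof (intro sum.cong refl)
    fix \<sigma> j assume "\<sigma> \<in> words P (Suc k)"
    then have "\<sigma> \<noteq> []" by (auto simp: words_def)
    then show "mass (\<sigma> @ [j]) * (b \<sigma> * d (last \<sigma>) j) = mass \<sigma> * b \<sigma> * (P $ last \<sigma> $ j * d (last \<sigma>) j)"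
      by (simp add: word_prod_snoc)
  qed
  finally show ?thesis by (simp add: sum_row assms)
qed

text \<open>Level \<open>k\<close> stands for words of length \<open>k + 1\<close>, so that all words in question are nonempty.\<close>

definition stop :: "real \<Rightarrow> (nat \<Rightarrow> 'n) \<Rightarrow> nat" where
  "stop \<epsilon> \<omega> = (LEAST k. mass (init_seg \<omega> (Suc k)) < \<epsilon>)"

lemma mass_decay: "\<exists>r. 0 < r \<and> r < 1 \<and>
  (\<forall>\<omega>\<in>inf_words P. \<forall>k l. mass (init_seg \<omega> (Suc (k + l))) \<le> mass (init_seg \<omega> (Suc k)) * r ^ l)"
proof -
  obtain r where r: "0 < r" "r < 1" "\<And>x. x \<in> UNIV \<Longrightarrow> (\<lambda>(i, j). P $ i $ j) x \<le> r"
    by (rule finite_upper_bound_less_1[of UNIV "\<lambda>(i, j). P $ i $ j"]) (auto simp: P_less_1)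
  have "mass (init_seg \<omega> (Suc (k + l))) \<le> mass (init_seg \<omega> (Suc k)) * r ^ l" if w: "\<omega> \<in> inf_words P" for \<omega> k l
  proof (induction l)
    case (Suc l)
    have "mass (init_seg \<omega> (Suc (k + Suc l))) = mass (init_seg \<omega> (Suc (k + l))) * P $ \<omega> (k + l) $ \<omega> (Suc (k + l))"
      by (simp only: add_Suc_right mass_Suc)
    also have "\<dots> \<le> (mass (init_seg \<omega> (Suc k)) * r ^ l) * r"
      using r(3)[of "(\<omega> (k + l), \<omega> (Suc (k + l)))"] P_nonneg mass_pos[OF w, of k] r(1)
      by (intro mult_mono Suc) (auto intro!: mult_nonneg_nonneg less_imp_le)
    finally show ?case by (simp only: power_Suc2 mult.assoc)
  qed simp
  then show ?thesis using r(1,2) by blast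
qed

lemma mass_le_1: "\<omega> \<in> inf_words P \<Longrightarrow> mass (init_seg \<omega> (Suc k)) \<le> 1"
  by (subst measure_cyl[OF init_seg_in_words, symmetric]) auto

text \<open>The level \<open>K\<close> is the same for all sequences, so for fixed
  \<open>\<epsilon>\<close> the stopping level is bounded. This reduces optional stopping to a
  finite sum.\<close>

lemma mass_uniformly_small:
  assumes "\<epsilon> > 0" shows "\<exists>K. \<forall>\<omega>\<in>inf_words P. mass (init_seg \<omega> (Suc K)) < \<epsilon>"
proof -
  obtain r where r: "0 < r" "r < 1"
    "\<And>\<omega> k l. \<omega> \<in> inf_words P \<Longrightarrow> mass (init_seg \<omega> (Suc (k + l))) \<le> mass (init_seg \<omega> (Suc k)) * r ^ l"
    using mass_decay by blast
  obtain K where "r ^ K < \<epsilon>" using real_arch_pow_inv[OF assms r(2)] by blast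
  moreover have "mass (init_seg \<omega> (Suc K)) \<le> r ^ K" if "\<omega> \<in> inf_words P" for \<omega>
  proof -
    have "mass (init_seg \<omega> (Suc 0)) * r ^ K \<le> 1 * r ^ K"
      using r(1) by (intro mult_right_mono[OF mass_le_1[OF that]]) simp
    then show ?thesis using r(3)[OF that, of 0 K] by simp
  qed
  ultimately show ?thesis by (intro exI[of _ K] ballI) (rule le_less_trans)
qed

lemma mass_antimono:
  assumes w: "\<omega> \<in> inf_words P" and kl: "k \<le> l"
  shows "mass (init_seg \<omega> (Suc l)) \<le> mass (init_seg \<omega> (Suc k))"
  using kl
proof (induction l rule: dec_induct)
  case (step l)
  have "mass (init_seg \<omega> (Suc (Suc l))) \<le> mass (init_seg \<omega> (Suc l)) * 1"
    unfolding mass_Suc using mass_pos[OF w, of l] P_less_1 by (intro mult_left_mono less_imp_le) auto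
  then show ?case using step by simp
qed simp

lemma mass_stop:
  assumes "\<epsilon> > 0" "\<omega> \<in> inf_words P" shows "mass (init_seg \<omega> (Suc (stop \<epsilon> \<omega>))) < \<epsilon>"
proof -
  obtain K where "mass (init_seg \<omega> (Suc K)) < \<epsilon>" using mass_uniformly_small[OF assms(1)] assms(2) by blast
  then show ?thesis unfolding stop_def by (rule LeastI)
qed

text \<open>Masses decrease along a sequence, so not having stopped at level \<open>l\<close> can be
  read off from level \<open>l\<close> alone. Hence the event depends only on the first
  \<open>l + 1\<close> letters, as required of a stopping time.\<close>

lemma less_stop_iff:
  assumes "\<epsilon> > 0" "\<omega> \<in> inf_words P" shows "l < stop \<epsilon> \<omega> \<longleftrightarrow> \<epsilon> \<le> mass (init_seg \<omega> (Suc l))"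
proof
  show "\<epsilon> \<le> mass (init_seg \<omega> (Suc l))" if "l < stop \<epsilon> \<omega>"
    using not_less_Least[OF that[unfolded stop_def]] by simp
  show "l < stop \<epsilon> \<omega>" if "\<epsilon> \<le> mass (init_seg \<omega> (Suc l))"
  proof (rule ccontr)
    assume "\<not> l < stop \<epsilon> \<omega>"
    then show False
      using that mass_stop[OF assms] mass_antimono[OF assms(2), of "stop \<epsilon> \<omega>" l] by linarith
  qed
qed

text \<open>If stopping occurs after level 0, the preceding mass was at least
  \<open>\<epsilon>\<close> and one letter costs at most the smallest positive entry
  \<open>p\<close> of \<open>P\<close>. If it occurs at level 0, the mass is an entry of
  \<open>q\<close>, hence at least \<open>a\<close>, and here \<open>\<epsilon> \<le> 1\<close> is
  used.\<close>

lemma mass_stop_lower: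
  "\<exists>b>0. b \<le> 1 \<and> (\<forall>\<epsilon>>0. \<epsilon> \<le> 1 \<longrightarrow> (\<forall>\<omega>\<in>inf_words P. b * \<epsilon> \<le> mass (init_seg \<omega> (Suc (stop \<epsilon> \<omega>)))))"
proof -
  obtain a where a: "0 < a" "a < 1" "\<And>i. a \<le> q $ i"
    using finite_pos_lower_bound[of UNIV "\<lambda>i. q $ i"] q_pos by auto
  obtain p where p: "0 < p" "p < 1" "\<And>x. x \<in> {(i, j). P $ i $ j > 0} \<Longrightarrow> p \<le> (\<lambda>(i, j). P $ i $ j) x"
    by (rule finite_pos_lower_bound[of "{(i, j). P $ i $ j > 0}" "\<lambda>(i, j). P $ i $ j"]) auto
  have "a * p * \<epsilon> \<le> mass (init_seg \<omega> (Suc (stop \<epsilon> \<omega>)))" if e: "\<epsilon> > 0" "\<epsilon> \<le> 1" and w: "\<omega> \<in> inf_words P" for \<epsilon> \<omega>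
  proof (cases "stop \<epsilon> \<omega>")
    case 0
    have "a * p * \<epsilon> \<le> a * 1 * 1" using a p e by (intro mult_mono) auto
    then show ?thesis using a(3)[of "\<omega> 0"] by (simp add: 0)
  next
    case (Suc k)
    have "\<epsilon> \<le> mass (init_seg \<omega> (Suc k))" using less_stop_iff[OF e(1) w, of k] Suc by simp
    moreover have "a * p \<le> P $ \<omega> k $ \<omega> (Suc k)"
    proof -
      have "a * p \<le> 1 * p" using a p by (intro mult_right_mono) auto
      then show ?thesis using p(3)[of "(\<omega> k, \<omega> (Suc k))"] P_inf_words[OF w, of k] by simp
    qed
    ultimately have "\<epsilon> * (a * p) \<le> mass (init_seg \<omega> (Suc k)) * P $ \<omega> k $ \<omega> (Suc k)"
      using a p e by (intro mult_mono) (auto simp: mass_pos[OF w] less_imp_le)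
    then show ?thesis unfolding Suc mass_Suc by (simp add: mult.commute)
  qed
  moreover have "a * p \<le> 1 * 1" using a p by (intro mult_mono) auto
  ultimately show ?thesis using a p by (intro exI[of _ "a * p"]) auto
qed

text \<open>Up to the stopping level of \<open>\<omega>\<close> both sequences have the same masses.
  In particular the stopped words form an antichain: distinct ones have disjoint cylinders.\<close>

lemma stop_eq_if_agree:
  assumes "\<epsilon> > 0" "\<omega> \<in> inf_words P" "\<omega>' \<in> inf_words P" "init_seg \<omega> (Suc (stop \<epsilon> \<omega>)) = init_seg \<omega>' (Suc (stop \<epsilon> \<omega>))"
  shows "stop \<epsilon> \<omega>' = stop \<epsilon> \<omega>"
proof -
  have "mass (init_seg \<omega>' (Suc l)) = mass (init_seg \<omega> (Suc l))" if "l \<le> stop \<epsilon> \<omega>" for l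
  proof -
    have "init_seg \<omega> (Suc l) = init_seg \<omega>' (Suc l)" using assms(4) that unfolding init_seg_eq_iff by auto
    then show ?thesis by simp
  qed
  then have "l < stop \<epsilon> \<omega>' \<longleftrightarrow> l < stop \<epsilon> \<omega>" if "l \<le> stop \<epsilon> \<omega>" for l
    using that less_stop_iff[OF assms(1)] assms(2,3) by simp
  \<comment> \<open>The equivalence is available only for
    \<open>l \<le> stop \<epsilon> \<omega>\<close>. Taking for \<open>l\<close> the smaller of the
    two stopping levels contradicts either strict inequality.\<close>
  then show ?thesis by (metis less_irrefl linorder_neqE_nat order.refl order.strict_implies_order)
qed

definition stopped_sum :: "real \<Rightarrow> ('n \<Rightarrow> 'n \<Rightarrow> real) \<Rightarrow> (nat \<Rightarrow> 'n) \<Rightarrow> real" where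
  "stopped_sum \<epsilon> f \<omega> = (\<Sum>l<stop \<epsilon> \<omega>. f (\<omega> l) (\<omega> (Suc l)))"

text \<open>Trades the random number of summands for a fixed number \<open>K\<close> with 0-1
  weights. By \<open>less_stop_iff\<close> the weight of term \<open>l\<close> is a function of the
  first \<open>l + 1\<close> letters, which is the form needed for martingale increments.\<close>

lemma stopped_sum_eq:
  assumes "\<epsilon> > 0"
  obtains K where "\<And>\<omega> f. \<omega> \<in> inf_words P \<Longrightarrow> stopped_sum \<epsilon> f \<omega> =
    (\<Sum>l<K. (if \<epsilon> \<le> mass (init_seg \<omega> (Suc l)) then 1 else 0) * f (\<omega> l) (\<omega> (Suc l)))"
proof -
  obtain K where K: "\<And>\<omega>. \<omega> \<in> inf_words P \<Longrightarrow> mass (init_seg \<omega> (Suc K)) < \<epsilon>"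
    using mass_uniformly_small[OF assms] by blast
  have "stopped_sum \<epsilon> f \<omega> = (\<Sum>l<K. (if \<epsilon> \<le> mass (init_seg \<omega> (Suc l)) then 1 else 0) * f (\<omega> l) (\<omega> (Suc l)))"
    if w: "\<omega> \<in> inf_words P" for \<omega> f
  proof -
    have "stop \<epsilon> \<omega> \<le> K" using K[OF w] less_stop_iff[OF assms w, of K] by auto
    then have "stopped_sum \<epsilon> f \<omega> = (\<Sum>l<K. if l < stop \<epsilon> \<omega> then f (\<omega> l) (\<omega> (Suc l)) else 0)"
      unfolding stopped_sum_def by (intro sum.mono_neutral_cong_left) auto
    then show ?thesis
      by (simp add: less_stop_iff[OF assms w] if_distrib[of "\<lambda>x. x * _"] cong: if_cong)
  qed
  then show thesis using that by blast
qed

lemma stopped_sum_term_prefix: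
  "b (init_seg \<omega> (Suc l)) * f (\<omega> l) (\<omega> (Suc l))
    = (\<lambda>\<tau>. b (butlast \<tau>) * f (last (butlast \<tau>)) (last \<tau>)) (init_seg \<omega> (Suc (Suc l)))"
  by (simp add: init_seg_Suc[of _ "Suc l"])

lemma integrable_stopped_sum:
  assumes "\<epsilon> > 0" shows "integrable M (stopped_sum \<epsilon> f)"
proof -
  obtain K where K: "\<And>\<omega> f. \<omega> \<in> inf_words P \<Longrightarrow> stopped_sum \<epsilon> f \<omega> =
    (\<Sum>l<K. (if \<epsilon> \<le> mass (init_seg \<omega> (Suc l)) then 1 else 0) * f (\<omega> l) (\<omega> (Suc l)))"
    using stopped_sum_eq[OF assms] by blast
  have "integrable M (\<lambda>\<omega>. (\<Sum>l<K. (if \<epsilon> \<le> mass (init_seg \<omega> (Suc l)) then 1 else 0) * f (\<omega> l) (\<omega> (Suc l))))"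
    by (intro Bochner_Integration.integrable_sum)
      (subst stopped_sum_term_prefix[where b = "\<lambda>\<sigma>. if \<epsilon> \<le> mass \<sigma> then 1 else 0"], rule integrable_prefix)
  then show ?thesis
    by (subst Bochner_Integration.integrable_cong[OF refl]) (auto simp: space_M K)
qed

text \<open>Each of the finitely many weighted terms is a martingale increment multiplied by a
  function of the past, so each has mean zero.\<close>

lemma optional_stopping:
  assumes "\<epsilon> > 0" "\<And>i. (\<Sum>j\<in>UNIV. P $ i $ j * d i j) = 0"
  shows "(\<integral>\<omega>. stopped_sum \<epsilon> d \<omega> \<partial>M) = 0"
proof -
  obtain K where K: "\<And>\<omega> f. \<omega> \<in> inf_words P \<Longrightarrow> stopped_sum \<epsilon> f \<omega> =
    (\<Sum>l<K. (if \<epsilon> \<le> mass (init_seg \<omega> (Suc l)) then 1 else 0) * f (\<omega> l) (\<omega> (Suc l)))"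
    using stopped_sum_eq[OF assms(1)] by blast
  have "(\<integral>\<omega>. stopped_sum \<epsilon> d \<omega> \<partial>M) =
     (\<integral>\<omega>. (\<Sum>l<K. (if \<epsilon> \<le> mass (init_seg \<omega> (Suc l)) then 1 else 0) * d (\<omega> l) (\<omega> (Suc l))) \<partial>M)"
    by (rule Bochner_Integration.integral_cong) (auto simp: space_M K)
  also have "\<dots> = (\<Sum>l<K. \<integral>\<omega>. (if \<epsilon> \<le> mass (init_seg \<omega> (Suc l)) then 1 else 0) * d (\<omega> l) (\<omega> (Suc l)) \<partial>M)"
    by (intro Bochner_Integration.integral_sum)
      (subst stopped_sum_term_prefix[where b = "\<lambda>\<sigma>. if \<epsilon> \<le> mass \<sigma> then 1 else 0"], rule integrable_prefix)
  also have "\<dots> = 0"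
    by (intro sum.neutral ballI) (simp only: integral_martingale_increment[where b = "\<lambda>\<sigma>. if \<epsilon> \<le> mass \<sigma> then 1 else 0", OF assms(2)])
  finally show ?thesis .
qed

text \<open>Corrected by a solution \<open>h\<close> of the Poisson equation, the sums of \<open>f\<close> along a sequence
  become a martingale.\<close>

lemma integral_stopped_sum_bounded:
  assumes "irreducible_matrix P" and v: "\<And>i. v $ i > 0" "v v* P = v"
    and F: "(\<Sum>i\<in>UNIV. v $ i * (\<Sum>j\<in>UNIV. P $ i $ j * f i j)) = 0"
  shows "\<exists>C. \<forall>\<epsilon>>0. \<bar>\<integral>\<omega>. stopped_sum \<epsilon> f \<omega> \<partial>M\<bar> \<le> C"
proof -
  define F' where "F' = (\<chi> i. \<Sum>j\<in>UNIV. P $ i $ j * f i j)"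
  have "v \<bullet> F' = 0" using F by (simp add: inner_vec_def F'_def)
  then obtain h where h: "h = F' + P *v h"
    using poisson_equation[OF P_nonneg assms(1) v] by blast
  \<comment> \<open>The row mean of \<open>d\<close> at \<open>i\<close> is
    \<open>F' + P *v h - h\<close> at \<open>i\<close>, which is zero by the choice of
    \<open>h\<close>. Along a sequence the added terms telescope, so they change every stopped sum
    by at most \<open>2 * norm h\<close>, whatever \<open>\<epsilon>\<close> is.\<close>
  define d where "d i j = f i j + h $ j - h $ i" for i j
  have d0: "(\<Sum>j\<in>UNIV. P $ i $ j * d i j) = 0" for i
  proof -
    have "(\<Sum>j\<in>UNIV. P $ i $ j * d i j) = F' $ i + (P *v h) $ i - (\<Sum>j\<in>UNIV. P $ i $ j) * h $ i"
      by (simp add: d_def F'_def matrix_vector_mult_def algebra_simps sum.distrib sum_subtractf sum_distrib_left)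
    then show ?thesis using arg_cong[OF h, of "\<lambda>x. x $ i"] by (simp add: P_row)
  qed
  have "\<bar>\<integral>\<omega>. stopped_sum \<epsilon> f \<omega> \<partial>M\<bar> \<le> 2 * norm h" if e: "\<epsilon> > 0" for \<epsilon>
  proof -
    have "\<bar>stopped_sum \<epsilon> f \<omega> - stopped_sum \<epsilon> d \<omega>\<bar> \<le> 2 * norm h" for \<omega>
    proof -
      have "stopped_sum \<epsilon> d \<omega> = stopped_sum \<epsilon> f \<omega> + (\<Sum>l<stop \<epsilon> \<omega>. h $ \<omega> (Suc l) - h $ \<omega> l)"
        by (simp add: stopped_sum_def d_def sum.distrib[symmetric] algebra_simps)
      also have "\<dots> = stopped_sum \<epsilon> f \<omega> + h $ \<omega> (stop \<epsilon> \<omega>) - h $ \<omega> 0"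
        using sum_lessThan_telescope[of "\<lambda>l. h $ \<omega> l"] by simp
      finally show ?thesis
        using component_le_norm_cart[of h "\<omega> (stop \<epsilon> \<omega>)"] component_le_norm_cart[of h "\<omega> 0"] by linarith
    qed
    then have "\<bar>\<integral>\<omega>. stopped_sum \<epsilon> f \<omega> - stopped_sum \<epsilon> d \<omega> \<partial>M\<bar> \<le> (\<integral>\<omega>. 2 * norm h \<partial>M)"
      by (intro order_trans[OF integral_abs_bound] integral_mono integrable_abs
          Bochner_Integration.integrable_diff integrable_stopped_sum e) auto
    then show ?thesis
      using optional_stopping[OF e d0] by (simp add: integrable_stopped_sum e prob_space)
  qed
  then show ?thesis by blast
qed

lemma ln_word_prod_stop:
  assumes "\<omega> \<in> inf_words P" "\<And>i j. P $ i $ j > 0 \<Longrightarrow> A $ i $ j > 0"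
  shows "ln (word_prod A (init_seg \<omega> (Suc (stop \<epsilon> \<omega>)))) = stopped_sum \<epsilon> (\<lambda>i j. ln (A $ i $ j)) \<omega>"
  unfolding word_prod_init_seg stopped_sum_def
proof (rule ln_prod)
  show "A $ \<omega> i $ \<omega> (Suc i) \<noteq> 0" for i using assms(2)[OF P_inf_words[OF assms(1), of i]] by simp
qed simp

end

section \<open>Geometry of the coding map\<close>

lemma ndist_bounded:
  fixes nrm :: "real^'d \<Rightarrow> real"
  assumes "is_norm nrm" "compact A"
  shows "\<exists>B. \<forall>x\<in>A. \<forall>y\<in>A. ndist nrm x y \<le> B"
proof -
  obtain K where K: "K > 0" "\<And>x. nrm x \<le> K * norm x" using is_norm_le_norm[OF assms(1)] by blast
  obtain b where b: "\<And>x. x \<in> A \<Longrightarrow> norm x \<le> b"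
    using compact_imp_bounded[OF assms(2)] by (auto simp: bounded_iff)
  have "ndist nrm x y \<le> K * (b + b)" if "x \<in> A" "y \<in> A" for x y
  proof -
    have "norm (x - y) \<le> b + b" using b[OF that(1)] b[OF that(2)] norm_triangle_ineq4[of x y] by linarith
    then show ?thesis
      using K(2)[of "x - y"] mult_left_mono[of "norm (x - y)" "b + b" K] K(1) unfolding ndist_def by linarith
  qed
  then show ?thesis by blast
qed

lemma ndist_le_ndiameter:
  fixes nrm :: "real^'d \<Rightarrow> real"
  assumes "is_norm nrm" "compact A" "x \<in> A" "y \<in> A"
  shows "ndist nrm x y \<le> ndiameter nrm A"
proof -
  obtain B where "\<forall>x\<in>A. \<forall>y\<in>A. ndist nrm x y \<le> B" using ndist_bounded[OF assms(1,2)] by blast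
  then have "bdd_above ((\<lambda>(x, y). ndist nrm x y) ` (A \<times> A))" by (auto intro!: bdd_aboveI[of _ B])
  from cSUP_upper[OF _ this, of "(x, y)"] show ?thesis
    using assms(3,4) by (auto simp: ndiameter_def)
qed

lemma ndiameter_mono:
  fixes nrm :: "real^'d \<Rightarrow> real"
  assumes "is_norm nrm" "compact B" "A \<subseteq> B" "A \<noteq> {}"
  shows "ndiameter nrm A \<le> ndiameter nrm B"
proof -
  have "(SUP (x, y)\<in>A \<times> A. ndist nrm x y) \<le> ndiameter nrm B"
    by (rule cSUP_least) (use assms ndist_le_ndiameter[OF assms(1,2)] in auto)
  then show ?thesis using assms(4) by (simp add: ndiameter_def)
qed

lemma ndiameter_pos:
  fixes nrm :: "real^'d \<Rightarrow> real"
  assumes "is_norm nrm" "compact A" "interior A \<noteq> {}"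
  shows "0 < ndiameter nrm A"
proof -
  obtain x e where e: "e > 0" "ball x e \<subseteq> A" using assms(3) by (auto simp: mem_interior)
  define y where "y = x + (e/2) *\<^sub>R axis undefined 1"
  have "y \<in> ball x e" using e(1) by (simp add: y_def dist_norm norm_axis_1)
  then have "x \<in> A" "y \<in> A" using e by auto
  moreover have "x - y \<noteq> 0" using e(1) by (simp add: y_def axis_eq_0_iff)
  then have "0 < ndist nrm x y"
    using assms(1) unfolding ndist_def is_norm_def by (simp add: less_le)
  ultimately show ?thesis using ndist_le_ndiameter[OF assms(1,2), of x y] by simp
qed

lemma nsetdist_le_ndist:
  assumes "is_norm nrm" "x \<in> A" "y \<in> B"
  shows "nsetdist nrm A B \<le> ndist nrm x y"
proof -
  have "Inf {ndist nrm x y |x y. x \<in> A \<and> y \<in> B} \<le> ndist nrm x y"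
    by (rule cInf_lower) (use assms ndist_nonneg[OF assms(1)] in \<open>auto intro!: bdd_belowI[of _ 0]\<close>)
  then show ?thesis using assms by (auto simp: nsetdist_def)
qed

text \<open>A similarity with respect to \<open>nrm\<close> is Lipschitz for the Euclidean norm by
  equivalence of norms, hence continuous. This gives compactness of the sets
  \<open>J \<sigma>\<close> for longer words, where it is not part of the definition.\<close>

lemma geom_similar_compact:
  fixes nrm :: "real^'d \<Rightarrow> real"
  assumes "is_norm nrm" "geom_similar nrm A B" "compact B"
  shows "compact A"
proof -
  obtain f r where f: "r > 0" "\<And>x y. ndist nrm (f x) (f y) = r * ndist nrm x y" "A = f ` B"
    using assms(2) by (auto simp: geom_similar_def)
  obtain K where K: "K > 0" "\<And>x. nrm x \<le> K * norm x" using is_norm_le_norm[OF assms(1)] by blast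
  obtain L where L: "L > 0" "\<And>x. norm x \<le> L * nrm x" using norm_le_is_norm[OF assms(1)] by blast
  have "norm (f x - f y) \<le> L * (r * K) * norm (x - y)" for x y
  proof -
    have "norm (f x - f y) \<le> L * (r * nrm (x - y))"
      using L(2)[of "f x - f y"] f(2)[of x y] by (simp add: ndist_def)
    also have "\<dots> \<le> L * (r * (K * norm (x - y)))"
      using K(2)[of "x - y"] L(1) f(1) by simp
    finally show ?thesis by (simp add: mult.assoc)
  qed
  then have "(L * (r * K))-lipschitz_on B f"
    using L(1) K(1) f(1) by (auto simp: lipschitz_on_def dist_norm)
  then show ?thesis
    unfolding f(3) by (intro compact_continuous_image lipschitz_on_continuous_on assms(3))
qed

section \<open>The sets of the construction and the coding map\<close>

locale mw_measure = markov_words P q M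
  for P :: "real^'n^'n" and q :: "real^'n" and M :: "(nat \<Rightarrow> 'n) measure" +
  fixes nrm :: "real^'d \<Rightarrow> real" and c :: "real^'n^'n"
    and J :: "'n list \<Rightarrow> (real^'d) set" and t :: real
  assumes norm: "is_norm nrm"
    and mw: "mauldin_williams nrm P c J"
    and t_pos: "0 < t"
    and sep: "\<And>\<sigma> j1 j2. \<sigma> \<in> all_words P \<Longrightarrow> j1 \<noteq> j2 \<Longrightarrow> \<sigma> @ [j1] \<in> all_words P \<Longrightarrow> \<sigma> @ [j2] \<in> all_words P \<Longrightarrow>
      t * max (ndiameter nrm (J (\<sigma> @ [j1]))) (ndiameter nrm (J (\<sigma> @ [j2])))
        \<le> nsetdist nrm (J (\<sigma> @ [j1])) (J (\<sigma> @ [j2]))"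
begin

abbreviation "diam \<sigma> \<equiv> ndiameter nrm (J \<sigma>)"
abbreviation "g \<equiv> coding_map J"

lemma J_single: "J [i] \<noteq> {}" "compact (J [i])" "interior (J [i]) \<noteq> {}"
proof -
  note * = spec[OF conjunct1[OF mw[unfolded mauldin_williams_def]], of i]
  show ne: "J [i] \<noteq> {}" and "compact (J [i])"
    by (rule conjunct1[OF *], rule conjunct1[OF conjunct2[OF *]])
  show "interior (J [i]) \<noteq> {}"
  proof
    assume "interior (J [i]) = {}"
    then have "closure (interior (J [i])) = {}" by (simp only: closure_empty)
    then have "J [i] = {}" by (rule trans[OF conjunct2[OF conjunct2[OF *]]])
    with ne show False by (rule notE)
  qed
qed

lemma c_bounds: "P $ i $ j > 0 \<Longrightarrow> 0 < c $ i $ j" "P $ i $ j > 0 \<Longrightarrow> c $ i $ j < 1"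
  using conjunct1[OF conjunct2[OF mw[unfolded mauldin_williams_def]]] by simp_all

lemma diam_single_pos: "0 < diam [i]"
  by (rule ndiameter_pos[OF norm J_single(2,3)])

lemma diam_single_bounds:
  "\<exists>a b. 0 < a \<and> 0 < b \<and> (\<forall>i. a \<le> diam [i] \<and> diam [i] \<le> b)"
proof -
  obtain a where a: "0 < a" "a < 1" "\<And>i. i \<in> UNIV \<Longrightarrow> a \<le> diam [i]"
    by (rule finite_pos_lower_bound[of UNIV "\<lambda>i. diam [i]"]) (simp_all add: diam_single_pos)
  have "diam [i] \<le> (\<Sum>i\<in>UNIV. diam [i])" for i
    by (rule member_le_sum) (auto simp: less_imp_le diam_single_pos)
  moreover have "0 < (\<Sum>i\<in>UNIV. diam [i])" by (rule sum_pos) (auto simp: diam_single_pos)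
  ultimately show ?thesis using a(1,3) by (intro exI[of _ a] exI[of _ "\<Sum>i\<in>UNIV. diam [i]"]) simp
qed

lemma J_snoc:
  assumes "\<sigma> @ [j] \<in> words P (Suc (Suc k))"
  shows "J (\<sigma> @ [j]) \<subseteq> J \<sigma>" "geom_similar nrm (J (\<sigma> @ [j])) (J [j])"
    "diam (\<sigma> @ [j]) = word_prod c (\<sigma> @ [j]) * diam [j]"
proof -
  have s: "\<sigma> \<in> words P (Suc k)" using assms snoc_in_words by blast
  then have *: "J (\<sigma> @ [j]) \<subseteq> J \<sigma>" "geom_similar nrm (J (\<sigma> @ [j])) (J [j])"
    "diam (\<sigma> @ [j]) / diam [j] = word_prod c (\<sigma> @ [j])"
  proof -
    have "1 \<le> Suc k" by simp
    from bspec[OF mp[OF spec[OF conjunct2[OF conjunct2[OF mw[unfolded mauldin_williams_def]]]] this] s]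
    have "\<sigma> @ [j] \<in> words P (Suc k + 1) \<longrightarrow> J (\<sigma> @ [j]) \<subseteq> J \<sigma> \<and>
      geom_similar nrm (J (\<sigma> @ [j])) (J [j]) \<and> diam (\<sigma> @ [j]) / diam [j] = word_prod c (\<sigma> @ [j])"
      by (elim conjE allE)
    then
    show "J (\<sigma> @ [j]) \<subseteq> J \<sigma>" "geom_similar nrm (J (\<sigma> @ [j])) (J [j])"
      "diam (\<sigma> @ [j]) / diam [j] = word_prod c (\<sigma> @ [j])" using assms by simp_all
  qed
  show "J (\<sigma> @ [j]) \<subseteq> J \<sigma>" "geom_similar nrm (J (\<sigma> @ [j])) (J [j])" by (rule *)+
  show "diam (\<sigma> @ [j]) = word_prod c (\<sigma> @ [j]) * diam [j]"
    using *(3) diam_single_pos[of j] by (simp add: field_simps)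
qed

lemma J_word:
  assumes "\<sigma> \<in> words P (Suc k)"
  shows "J \<sigma> \<noteq> {}" "compact (J \<sigma>)" "diam \<sigma> = word_prod c \<sigma> * diam [last \<sigma>]"
proof -
  have "J \<sigma> \<noteq> {} \<and> compact (J \<sigma>) \<and> diam \<sigma> = word_prod c \<sigma> * diam [last \<sigma>]"
  proof (cases k)
    case 0
    then obtain i where "\<sigma> = [i]" using assms by (auto simp: words_def length_Suc_conv)
    then show ?thesis using J_single by simp
  next
    case (Suc k')
    then obtain \<tau> j where t: "\<sigma> = \<tau> @ [j]" using assms by (cases \<sigma> rule: rev_cases) (auto simp: words_def)
    note J = J_snoc[of \<tau> j k', folded t, OF assms[unfolded Suc]]
    have "J \<sigma> \<noteq> {}" using J(2) J_single(1)[of j] by (auto simp: geom_similar_def)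
    then show ?thesis using J geom_similar_compact[OF norm J(2) J_single(2)] by (simp add: t)
  qed
  then show "J \<sigma> \<noteq> {}" "compact (J \<sigma>)" "diam \<sigma> = word_prod c \<sigma> * diam [last \<sigma>]" by auto
qed

lemma J_init_seg:
  assumes "\<omega> \<in> inf_words P"
  shows "J (init_seg \<omega> (Suc k)) \<noteq> {}" "compact (J (init_seg \<omega> (Suc k)))"
  by (rule J_word[OF init_seg_in_words[OF assms]])+

lemma J_Suc: "\<omega> \<in> inf_words P \<Longrightarrow> J (init_seg \<omega> (Suc (Suc k))) \<subseteq> J (init_seg \<omega> (Suc k))"
  using J_snoc(1)[of "init_seg \<omega> (Suc k)" "\<omega> (Suc k)" k] init_seg_in_words[of \<omega> P "Suc (Suc k)"]
  by (simp add: init_seg_Suc[of _ "Suc k"])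

lemma J_antimono: "\<omega> \<in> inf_words P \<Longrightarrow> k \<le> l \<Longrightarrow> J (init_seg \<omega> (Suc l)) \<subseteq> J (init_seg \<omega> (Suc k))"
  by (rule lift_Suc_antimono_le[of "\<lambda>k. J (init_seg \<omega> (Suc k))"]) (auto intro: J_Suc[THEN subsetD])

lemma diam_antimono: "\<omega> \<in> inf_words P \<Longrightarrow> k \<le> l \<Longrightarrow> diam (init_seg \<omega> (Suc l)) \<le> diam (init_seg \<omega> (Suc k))"
  by (intro ndiameter_mono[OF norm] J_antimono J_init_seg)

lemma diam_init_seg:
  "\<omega> \<in> inf_words P \<Longrightarrow> diam (init_seg \<omega> (Suc k)) = word_prod c (init_seg \<omega> (Suc k)) * diam [\<omega> k]"
  using J_word(3)[OF init_seg_in_words, of \<omega> k] by simp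

lemma word_prod_c_pos: "\<omega> \<in> inf_words P \<Longrightarrow> 0 < word_prod c (init_seg \<omega> (Suc k))"
  unfolding word_prod_init_seg by (intro prod_pos c_bounds(1) P_inf_words)

lemma word_prod_c_decay:
  "\<exists>r. 0 < r \<and> r < 1 \<and> (\<forall>\<omega>\<in>inf_words P. \<forall>k. word_prod c (init_seg \<omega> (Suc k)) \<le> r ^ k)"
proof -
  obtain r where r: "0 < r" "r < 1" "\<And>x. x \<in> {(i, j). P $ i $ j > 0} \<Longrightarrow> (\<lambda>(i, j). c $ i $ j) x \<le> r"
    by (rule finite_upper_bound_less_1[of "{(i, j). P $ i $ j > 0}" "\<lambda>(i, j). c $ i $ j"]) (auto simp: c_bounds)
  have "word_prod c (init_seg \<omega> (Suc k)) \<le> r ^ k" if w: "\<omega> \<in> inf_words P" for \<omega> k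
  proof -
    have "word_prod c (init_seg \<omega> (Suc k)) \<le> (\<Prod>l<k. r)"
      unfolding word_prod_init_seg
    proof (rule prod_mono)
      fix l
      show "0 \<le> c $ \<omega> l $ \<omega> (Suc l) \<and> c $ \<omega> l $ \<omega> (Suc l) \<le> r"
        using r(3)[of "(\<omega> l, \<omega> (Suc l))"] P_inf_words[OF w, of l] c_bounds(1)[OF P_inf_words[OF w, of l]] by simp
    qed
    then show ?thesis by simp
  qed
  then show ?thesis using r(1,2) by blast
qed

lemma word_prod_c_lower:
  "\<exists>r. 0 < r \<and> r < 1 \<and> (\<forall>\<omega>\<in>inf_words P. \<forall>k l.
     word_prod c (init_seg \<omega> (Suc k)) * r ^ l \<le> word_prod c (init_seg \<omega> (Suc (k + l))))"
proof -
  obtain r where r: "0 < r" "r < 1" "\<And>x. x \<in> {(i, j). P $ i $ j > 0} \<Longrightarrow> r \<le> (\<lambda>(i, j). c $ i $ j) x"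
    by (rule finite_pos_lower_bound[of "{(i, j). P $ i $ j > 0}" "\<lambda>(i, j). c $ i $ j"]) (auto simp: c_bounds)
  have "word_prod c (init_seg \<omega> (Suc k)) * r ^ l \<le> word_prod c (init_seg \<omega> (Suc (k + l)))"
    if w: "\<omega> \<in> inf_words P" for \<omega> k l
  proof (induction l)
    case (Suc l)
    have "(word_prod c (init_seg \<omega> (Suc k)) * r ^ l) * r
        \<le> word_prod c (init_seg \<omega> (Suc (k + l))) * c $ \<omega> (k + l) $ \<omega> (Suc (k + l))"
      using r(3)[of "(\<omega> (k + l), \<omega> (Suc (k + l)))"] P_inf_words[OF w, of "k + l"] r(1)
      by (intro mult_mono Suc less_imp_le[OF word_prod_c_pos[OF w]]) simp_all
    then show ?case by (simp only: add_Suc_right word_prod_init_seg_Suc power_Suc2 mult.assoc)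
  qed simp
  then show ?thesis using r(1,2) by blast
qed

lemma diam_init_seg_tendsto:
  assumes "\<omega> \<in> inf_words P" shows "(\<lambda>k. diam (init_seg \<omega> (Suc k))) \<longlonglongrightarrow> 0"
proof -
  obtain r where r: "0 < r" "r < 1" "\<And>k. word_prod c (init_seg \<omega> (Suc k)) \<le> r ^ k"
    using word_prod_c_decay assms by blast
  obtain b where b: "\<And>i. diam [i] \<le> b" using diam_single_bounds by blast
  have "(\<lambda>k. r ^ k * b) \<longlonglongrightarrow> 0 * b"
    by (intro tendsto_mult_right LIMSEQ_power_zero) (use r(1,2) in simp)
  then have lim: "(\<lambda>k. r ^ k * b) \<longlonglongrightarrow> 0" by (simp only: mult_zero_left)
  have "diam (init_seg \<omega> (Suc k)) \<le> r ^ k * b" for k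
    unfolding diam_init_seg[OF assms]
    using r(1) by (intro mult_mono r(3) b less_imp_le[OF diam_single_pos]) simp
  moreover have "0 \<le> diam (init_seg \<omega> (Suc k))" for k
    unfolding diam_init_seg[OF assms]
    by (intro mult_nonneg_nonneg less_imp_le[OF diam_single_pos] less_imp_le[OF word_prod_c_pos[OF assms]])
  ultimately show ?thesis
    by (intro tendsto_sandwich[OF _ _ tendsto_const lim] always_eventually allI)
qed

text \<open>The sets along a sequence are nested, compact and nonempty with diameters tending to 0,
  so they meet in exactly one point. This makes the definite description in
  \<open>coding_map\<close> meaningful.\<close>

lemma coding_map_mem:
  assumes w: "\<omega> \<in> inf_words P" shows "g \<omega> \<in> J (init_seg \<omega> (Suc k))"
proof -
  let ?S = "\<lambda>k. J (init_seg \<omega> (Suc k))"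
  have eq: "(\<Inter>k\<in>{1..}. J (init_seg \<omega> k)) = (\<Inter>k. ?S k)"
  proof (intro equalityI subsetI INT_I)
    fix x k assume x: "x \<in> (\<Inter>k. ?S k)" and k: "k \<in> {1::nat..}"
    from k obtain l where "k = Suc l" by (cases k) auto
    then show "x \<in> J (init_seg \<omega> k)" using x by blast
  qed auto
  have "(\<Inter>k. ?S k) \<noteq> {}"
  proof (rule compact_nest)
    show "compact (?S k)" "?S k \<noteq> {}" for k by (rule J_init_seg[OF w])+
    show "?S n \<subseteq> ?S m" if "m \<le> n" for m n using J_antimono[OF w that] .
  qed
  then obtain x where x: "x \<in> (\<Inter>k. ?S k)" by blast
  have "y = x" if y: "y \<in> (\<Inter>k. ?S k)" for y
  proof -
    have "ndist nrm y x \<le> diam (init_seg \<omega> (Suc k))" for k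
      using x y by (intro ndist_le_ndiameter[OF norm] J_init_seg[OF w]) auto
    then have "ndist nrm y x \<le> 0"
      by (intro LIMSEQ_le_const[OF diam_init_seg_tendsto[OF w]]) blast
    then have "nrm (y - x) = 0" using ndist_nonneg[OF norm, of y x] by (simp add: ndist_def)
    then have "y - x = 0" using norm unfolding is_norm_def by blast
    then show "y = x" by simp
  qed
  then have "\<exists>!x. x \<in> (\<Inter>k. ?S k)" by (intro ex1I[of _ x] x)
  from theI'[OF this] show ?thesis unfolding coding_map_def eq by blast
qed

text \<open>The coding map is a pointwise limit of functions of finite prefixes: choose one point in
  each \<open>J \<sigma>\<close>; its distance to the coded point is controlled by the vanishing
  diameters.\<close>

lemma measurable_coding_map [measurable]: "g \<in> borel_measurable M"
proof (rule borel_measurable_LIMSEQ_metric)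
  define p where "p \<sigma> = (SOME x. x \<in> J \<sigma>)" for \<sigma>
  have p: "p \<sigma> \<in> J \<sigma>" if "\<sigma> \<in> words P (Suc k)" for \<sigma> k
    unfolding p_def using J_word(1)[OF that] by (simp add: some_in_eq)
  show "(\<lambda>\<omega>. p (init_seg \<omega> (Suc k))) \<in> borel_measurable M" for k
    by measurable
  show "(\<lambda>k. p (init_seg \<omega> (Suc k))) \<longlonglongrightarrow> g \<omega>" if "\<omega> \<in> space M" for \<omega>
  proof -
    have w: "\<omega> \<in> inf_words P" using that by (simp add: space_M)
    obtain L where L: "L > 0" "\<And>x. norm x \<le> L * nrm x" using norm_le_is_norm[OF norm] by blast
    have "dist (p (init_seg \<omega> (Suc k))) (g \<omega>) \<le> L * diam (init_seg \<omega> (Suc k))" for k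
    proof -
      have "ndist nrm (p (init_seg \<omega> (Suc k))) (g \<omega>) \<le> diam (init_seg \<omega> (Suc k))"
        by (intro ndist_le_ndiameter[OF norm] J_init_seg[OF w] p[OF init_seg_in_words[OF w]] coding_map_mem[OF w])
      then have "L * ndist nrm (p (init_seg \<omega> (Suc k))) (g \<omega>) \<le> L * diam (init_seg \<omega> (Suc k))"
        using L(1) by (intro mult_left_mono) auto
      then show ?thesis
        using L(2)[of "p (init_seg \<omega> (Suc k)) - g \<omega>"] unfolding dist_norm ndist_def by linarith
    qed
    moreover have "(\<lambda>k. L * diam (init_seg \<omega> (Suc k))) \<longlonglongrightarrow> 0"
      using tendsto_mult_right_zero[OF diam_init_seg_tendsto[OF w]] .
    ultimately show ?thesis
      by (subst tendsto_dist_iff)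
         (rule tendsto_sandwich[of "\<lambda>_. 0" _ _ "\<lambda>k. L * diam (init_seg \<omega> (Suc k))"], simp_all)
  qed
qed

text \<open>At the first difference \<open>h\<close> the two words of length \<open>h + 1\<close>
  are siblings over the common prefix of length \<open>h\<close>, so the separation property
  applies. For \<open>h = 0\<close> the prefix is the empty word.\<close>

lemma coding_map_separated:
  assumes w: "\<omega> \<in> inf_words P" "\<omega>' \<in> inf_words P" and h: "\<omega> h \<noteq> \<omega>' h" "\<And>i. i < h \<Longrightarrow> \<omega> i = \<omega>' i"
  shows "t * max (diam (init_seg \<omega> (Suc h))) (diam (init_seg \<omega>' (Suc h))) \<le> ndist nrm (g \<omega>) (g \<omega>')"
proof -
  have e: "init_seg \<omega>' h = init_seg \<omega> h" using h(2) by (simp add: init_seg_eq_iff)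
  have aw: "init_seg \<eta> k \<in> all_words P" if "\<eta> \<in> inf_words P" for \<eta> k
    using init_seg_in_words[OF that] unfolding all_words_def by blast
  have s: "init_seg \<omega> h @ [\<omega> h] = init_seg \<omega> (Suc h)" "init_seg \<omega> h @ [\<omega>' h] = init_seg \<omega>' (Suc h)"
    by (simp_all add: init_seg_Suc e)
  have "t * max (diam (init_seg \<omega> (Suc h))) (diam (init_seg \<omega>' (Suc h)))
      \<le> nsetdist nrm (J (init_seg \<omega> (Suc h))) (J (init_seg \<omega>' (Suc h)))"
    using sep[of "init_seg \<omega> h" "\<omega> h" "\<omega>' h", unfolded s, OF aw[OF w(1)] h(1) aw[OF w(1)] aw[OF w(2)]] .
  also have "\<dots> \<le> ndist nrm (g \<omega>) (g \<omega>')"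
    by (rule nsetdist_le_ndist[OF norm coding_map_mem[OF w(1)] coding_map_mem[OF w(2)]])
  finally show ?thesis .
qed

text \<open>The radius is relative to the diameter \<open>k\<close> levels below the stopping level
  of the sequence itself, so it varies with \<open>\<omega>\<close>. The factor \<open>t / 2\<close>
  is chosen so that the distances of two such sequences to \<open>a\<close> add up to less than the
  separation gap.\<close>

definition near :: "real \<Rightarrow> real^'d \<Rightarrow> nat \<Rightarrow> (nat \<Rightarrow> 'n) set" where
  "near \<epsilon> a k = {\<omega> \<in> inf_words P. ndist nrm (g \<omega>) a < t / 2 * diam (init_seg \<omega> (Suc (stop \<epsilon> \<omega> + k)))}"

lemma near_same_cylinder:
  assumes e: "\<epsilon> > 0" and w: "\<omega> \<in> near \<epsilon> a k" "\<omega>' \<in> near \<epsilon> a k"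
  shows "init_seg \<omega>' (Suc (stop \<epsilon> \<omega> + k)) = init_seg \<omega> (Suc (stop \<epsilon> \<omega> + k))"
proof (rule ccontr)
  have i: "\<omega> \<in> inf_words P" "\<omega>' \<in> inf_words P" using w by (auto simp: near_def)
  assume "\<not> ?thesis"
  then obtain i where i': "i \<le> stop \<epsilon> \<omega> + k" "\<omega> i \<noteq> \<omega>' i" by (auto simp: init_seg_eq_iff less_Suc_eq_le)
  define h where "h = (LEAST i. \<omega> i \<noteq> \<omega>' i)"
  have h: "\<omega> h \<noteq> \<omega>' h" "\<And>i. i < h \<Longrightarrow> \<omega> i = \<omega>' i" "h \<le> stop \<epsilon> \<omega> + k"
  proof -
    show "\<omega> h \<noteq> \<omega>' h" unfolding h_def using i'(2) by (rule LeastI)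
    show "\<omega> j = \<omega>' j" if "j < h" for j using not_less_Least[OF that[unfolded h_def]] by simp
    have "h \<le> i" unfolding h_def using i'(2) by (rule Least_le)
    then show "h \<le> stop \<epsilon> \<omega> + k" using i'(1) by simp
  qed
  show False
  \<comment> \<open>If \<open>h\<close> is within reach of both levels, both radii are bounded by
    the diameters at level \<open>h\<close>, and the triangle inequality violates separation.
    Otherwise the sequences agree beyond the stopping level of \<open>\<omega>'\<close>, so their
    stopping levels coincide and \<open>h\<close> is within reach after all.\<close>
  proof (cases "h \<le> stop \<epsilon> \<omega>' + k")
    case True
    have "ndist nrm (g \<omega>) (g \<omega>') \<le> ndist nrm (g \<omega>) a + ndist nrm (g \<omega>') a"
      using ndist_triangle[OF norm, of "g \<omega>" "g \<omega>'" a] ndist_commute[OF norm, of a "g \<omega>'"] by simp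
    also have "\<dots> < t / 2 * diam (init_seg \<omega> (Suc (stop \<epsilon> \<omega> + k))) + t / 2 * diam (init_seg \<omega>' (Suc (stop \<epsilon> \<omega>' + k)))"
      using w by (intro add_strict_mono) (auto simp: near_def)
    also have "\<dots> \<le> t / 2 * diam (init_seg \<omega> (Suc h)) + t / 2 * diam (init_seg \<omega>' (Suc h))"
      using True h(3) i t_pos by (intro add_mono mult_left_mono diam_antimono) auto
    also have "\<dots> \<le> t / 2 * max (diam (init_seg \<omega> (Suc h))) (diam (init_seg \<omega>' (Suc h)))
        + t / 2 * max (diam (init_seg \<omega> (Suc h))) (diam (init_seg \<omega>' (Suc h)))"
      using t_pos by (intro add_mono mult_left_mono max.cobounded1 max.cobounded2) auto
    also have "\<dots> = t * max (diam (init_seg \<omega> (Suc h))) (diam (init_seg \<omega>' (Suc h)))" by simp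
    also have "\<dots> \<le> ndist nrm (g \<omega>) (g \<omega>')" by (rule coding_map_separated[OF i h(1,2)])
    finally show False by simp
  next
    case False
    then have "init_seg \<omega>' (Suc (stop \<epsilon> \<omega>')) = init_seg \<omega> (Suc (stop \<epsilon> \<omega>'))"
      using h(2) by (auto simp: init_seg_eq_iff)
    from stop_eq_if_agree[OF e i(2,1) this] show False using False h(3) by simp
  qed
qed

text \<open>All of \<open>near \<epsilon> a k\<close> lies in the cylinder of any one of its
  members, cut \<open>k\<close> levels below stopping. Its mass is below \<open>\<epsilon>\<close>
  at the stopping level and shrinks by a factor at most \<open>r\<close> with each further
  letter.\<close>

lemma near_in_small_cylinder:
  "\<exists>r. 0 < r \<and> r < 1 \<and> (\<forall>\<epsilon>>0. \<forall>a k. \<exists>C\<in>sets M. near \<epsilon> a k \<subseteq> C \<and> measure M C \<le> \<epsilon> * r ^ k)"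
proof -
  obtain r where r: "0 < r" "r < 1"
    "\<And>\<omega> k l. \<omega> \<in> inf_words P \<Longrightarrow> mass (init_seg \<omega> (Suc (k + l))) \<le> mass (init_seg \<omega> (Suc k)) * r ^ l"
    using mass_decay by blast
  have "\<exists>C\<in>sets M. near \<epsilon> a k \<subseteq> C \<and> measure M C \<le> \<epsilon> * r ^ k" if e: "\<epsilon> > 0" for \<epsilon> a k
  proof (cases "near \<epsilon> a k = {}")
    case True
    moreover have "0 \<le> \<epsilon> * r ^ k" using e r(1) by simp
    ultimately show ?thesis by (intro bexI[of _ "{}"]) simp_all
  next
    case False
    then obtain \<omega> where w: "\<omega> \<in> near \<epsilon> a k" by blast
    then have i: "\<omega> \<in> inf_words P" by (simp add: near_def)
    let ?\<sigma> = "init_seg \<omega> (Suc (stop \<epsilon> \<omega> + k))"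
    have "near \<epsilon> a k \<subseteq> cyl ?\<sigma>"
      using near_same_cylinder[OF e w] by (auto simp: near_def)
    moreover have "measure M (cyl ?\<sigma>) = mass ?\<sigma>" by (rule measure_cyl[OF init_seg_in_words[OF i]])
    moreover have "mass ?\<sigma> \<le> mass (init_seg \<omega> (Suc (stop \<epsilon> \<omega>))) * r ^ k" by (rule r(3)[OF i])
    moreover have "\<dots> \<le> \<epsilon> * r ^ k" using mass_stop[OF e i] r(1) by (intro mult_right_mono) auto
    ultimately have "near \<epsilon> a k \<subseteq> cyl ?\<sigma> \<and> measure M (cyl ?\<sigma>) \<le> \<epsilon> * r ^ k" by linarith
    then show ?thesis by (rule bexI[OF _ cyl_sets])
  qed
  then show ?thesis using r(1,2) by blast
qed

end

section \<open>Bounds for the geometric mean error\<close>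

text \<open>The remainder \<open>R\<close> may be infinite where \<open>f\<close> is
  \<open>-\<infinity>\<close>, so a direct subtraction is impossible. The inequality is rearranged
  into positive and negative parts, leaving only nonnegative terms, and integrated in that
  form.\<close>

lemma ereal_integral_lower:
  assumes f [measurable]: "f \<in> borel_measurable M" and R [measurable]: "R \<in> borel_measurable M"
    and w: "integrable M w" and B: "(\<integral>\<^sup>+x. R x \<partial>M) \<le> ennreal B" "0 \<le> B"
    and le: "\<And>x. x \<in> space M \<Longrightarrow> ereal (w x) \<le> f x + enn2ereal (R x)"
  shows "ereal ((\<integral>x. w x \<partial>M) - B) \<le> ereal_integral M f"
proof -
  have [measurable]: "w \<in> borel_measurable M" using w by auto
  let ?p = "\<integral>\<^sup>+x. e2ennreal (f x) \<partial>M" and ?n = "\<integral>\<^sup>+x. e2ennreal (- f x) \<partial>M"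
  obtain a where a: "0 \<le> a" "(\<integral>\<^sup>+x. ennreal (w x) \<partial>M) = ennreal a"
    using w by (metis ennreal_cases integrableD(2) infinity_ennreal_def)
  obtain b where b: "0 \<le> b" "(\<integral>\<^sup>+x. ennreal (- w x) \<partial>M) = ennreal b"
    using w by (metis ennreal_cases integrableD(3) infinity_ennreal_def)
  have ab: "(\<integral>x. w x \<partial>M) = a - b"
    using real_lebesgue_integral_def[OF w] a b by simp
  have "e2ennreal (- f x) + ennreal (w x) \<le> e2ennreal (f x) + ennreal (- w x) + R x" if "x \<in> space M" for x
  proof (cases rule: ereal2_cases[of "f x" "enn2ereal (R x)"])
    case (real_real y r)
    then have r: "R x = ennreal r" "0 \<le> r" by (metis enn2ereal_ennreal enn2ereal_inject enn2ereal_nonneg ereal_less_eq(5))+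
    have "ennreal (- y) + ennreal (w x) \<le> ennreal y + ennreal (- w x) + ennreal r"
      using le[OF that] r(2) by (cases "y \<ge> 0"; cases "w x \<ge> 0")
        (simp_all add: real_real ennreal_neg flip: ennreal_plus)
    then show ?thesis by (simp add: real_real r(1))
  qed (use le[OF that] in \<open>auto simp: e2ennreal_neg\<close>)
  then have "(\<integral>\<^sup>+x. e2ennreal (- f x) + ennreal (w x) \<partial>M) \<le> (\<integral>\<^sup>+x. e2ennreal (f x) + ennreal (- w x) + R x \<partial>M)"
    by (rule nn_integral_mono)
  then have "?n + ennreal a \<le> ?p + ennreal b + (\<integral>\<^sup>+x. R x \<partial>M)"
    by (simp add: nn_integral_add a b)
  also have "\<dots> \<le> ?p + ennreal b + ennreal B" by (intro add_left_mono B)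
  finally have *: "?n + ennreal a \<le> ?p + ennreal b + ennreal B" .
  show ?thesis
  proof (cases ?p rule: ennreal_cases)
    \<comment> \<open>An infinite positive part makes the extended integral
      \<open>\<infinity>\<close>, even if the negative part is infinite too, because
      \<open>\<infinity> - \<infinity> = \<infinity>\<close> for \<open>ereal\<close>.\<close>
    case top
    then show ?thesis by (simp add: ereal_integral_def)
  next
    case (real p)
    have "?n \<noteq> top"
    proof
      assume n: "?n = top"
      show False using * unfolding n real(2) using real(1) b(1) B(2) by (simp flip: ennreal_plus add: top_unique)
    qed
    then obtain n where n: "0 \<le> n" "?n = ennreal n" by (metis ennreal_cases)
    have "n + a \<le> p + b + B"
      using * a(1) b(1) B(2) real(1) n(1) unfolding n(2) real(2) by (simp flip: ennreal_plus)
    then show ?thesis unfolding ereal_integral_def n(2) real(2) ab using n(1) real(1) by (simp add: enn2ereal_ennreal)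
  qed
qed

lemma ereal_integral_upper:
  assumes f [measurable]: "f \<in> borel_measurable M" and w: "integrable M w"
    and le: "\<And>x. x \<in> space M \<Longrightarrow> f x \<le> ereal (w x)"
  shows "ereal_integral M f \<le> ereal (\<integral>x. w x \<partial>M)"
proof -
  have [measurable]: "w \<in> borel_measurable M" using w by auto
  let ?p = "\<integral>\<^sup>+x. e2ennreal (f x) \<partial>M" and ?n = "\<integral>\<^sup>+x. e2ennreal (- f x) \<partial>M"
  obtain a where a: "0 \<le> a" "(\<integral>\<^sup>+x. ennreal (w x) \<partial>M) = ennreal a"
    using w by (metis ennreal_cases integrableD(2) infinity_ennreal_def)
  obtain b where b: "0 \<le> b" "(\<integral>\<^sup>+x. ennreal (- w x) \<partial>M) = ennreal b"
    using w by (metis ennreal_cases integrableD(3) infinity_ennreal_def)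
  have ab: "(\<integral>x. w x \<partial>M) = a - b"
    using real_lebesgue_integral_def[OF w] a b by simp
  have "?p \<le> (\<integral>\<^sup>+x. ennreal (w x) \<partial>M)"
    by (rule nn_integral_mono) (metis e2ennreal_mono e2ennreal_ereal le)
  then obtain p where p: "0 \<le> p" "?p = ennreal p" unfolding a(2) by (metis ennreal_cases ennreal_less_top neq_top_trans top.not_eq_extremum)
  have "e2ennreal (f x) + ennreal (- w x) \<le> e2ennreal (- f x) + ennreal (w x)" if "x \<in> space M" for x
  proof (cases "f x")
    case (real y)
    then show ?thesis
      using le[OF that] by (cases "y \<ge> 0"; cases "w x \<ge> 0") (simp_all add: ennreal_neg flip: ennreal_plus)
  qed (use le[OF that] in \<open>auto simp: e2ennreal_neg\<close>)
  then have "(\<integral>\<^sup>+x. e2ennreal (f x) + ennreal (- w x) \<partial>M) \<le> (\<integral>\<^sup>+x. e2ennreal (- f x) + ennreal (w x) \<partial>M)"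
    by (rule nn_integral_mono)
  then have *: "ennreal p + ennreal b \<le> ?n + ennreal a"
    by (simp add: nn_integral_add a b p)
  show ?thesis
  proof (cases ?n rule: ennreal_cases)
    case top
    then show ?thesis by (simp add: ereal_integral_def p enn2ereal_ennreal)
  next
    case (real n)
    have "p + b \<le> n + a"
      using * a(1) b(1) p(1) real(1) unfolding real(2) by (simp flip: ennreal_plus)
    then show ?thesis unfolding ereal_integral_def p(2) real(2) ab using p(1) real(1) by (simp add: enn2ereal_ennreal)
  qed
qed

lemma ereal_integral_distr:
  assumes "g \<in> borel_measurable M" "f \<in> borel_measurable borel"
  shows "ereal_integral (distr M borel g) f = ereal_integral M (\<lambda>x. f (g x))"
  using assms by (simp add: ereal_integral_def nn_integral_distr)

lemma elog_ereal: "elog (ereal r) = (if r \<le> 0 then -\<infinity> else ereal (ln r))"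
  by (simp add: elog_def)

lemma elog_mono: "r \<le> s \<Longrightarrow> 0 < s \<Longrightarrow> elog (ereal r) \<le> ereal (ln s)"
  by (simp add: elog_ereal)

lemma borel_measurable_elog_ninfdist:
  fixes nrm :: "real^'d \<Rightarrow> real"
  assumes "is_norm nrm" "finite \<alpha>" "\<alpha> \<noteq> {}"
  shows "(\<lambda>x. elog (ereal (ninfdist nrm x \<alpha>))) \<in> borel_measurable borel"
  using borel_measurable_ninfdist[OF assms] unfolding elog_ereal by measurable

lemma eexp_mono_lower: "ereal B \<le> x \<Longrightarrow> ereal (exp B) \<le> eexp x"
  by (cases x) (auto simp: eexp_def)

lemma eexp_mono_upper: "x \<le> ereal B \<Longrightarrow> eexp x \<le> ereal (exp B)"
  by (cases x) (auto simp: eexp_def)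

section \<open>The mean logarithmic diameter and the upper bound\<close>

locale irreducible_mw_measure = mw_measure P q M nrm c J t
  for P :: "real^'n^'n" and q :: "real^'n" and M :: "(nat \<Rightarrow> 'n) measure"
    and nrm :: "real^'d \<Rightarrow> real" and c :: "real^'n^'n"
    and J :: "'n list \<Rightarrow> (real^'d) set" and t :: real +
  fixes v :: "real^'n"
  assumes irreducible: "irreducible_matrix P"
    and v: "\<And>i. v $ i > 0" "v v* P = v"
begin

abbreviation "d0 \<equiv> entropy_exponent P c v"

text \<open>Applied to \<open>P\<close> and to \<open>c\<close>, it shows that numerator and
  denominator of the exponent are both negative, so the exponent is well defined and positive.
  Branching ensures that no row sum is empty.\<close>

lemma sum_ln_neg:
  assumes "\<And>i j. P $ i $ j > 0 \<Longrightarrow> 0 < A $ i $ j" "\<And>i j. P $ i $ j > 0 \<Longrightarrow> A $ i $ j < 1"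
  shows "(\<Sum>i\<in>UNIV. v $ i * (\<Sum>j | P $ i $ j > 0. P $ i $ j * ln (A $ i $ j))) < 0"
proof -
  have "(\<Sum>j | P $ i $ j > 0. P $ i $ j * ln (A $ i $ j)) < 0" for i
  proof -
    have "{j. P $ i $ j > 0} \<noteq> {}" using branching[of i] by (metis card.empty not_numeral_le_zero)
    then have "(\<Sum>j | P $ i $ j > 0. P $ i $ j * ln (A $ i $ j)) < (\<Sum>j | P $ i $ j > 0. 0)"
      using assms by (intro sum_strict_mono) (auto simp: mult_less_0_iff)
    then show ?thesis by simp
  qed
  then have "(\<Sum>i\<in>UNIV. v $ i * (\<Sum>j | P $ i $ j > 0. P $ i $ j * ln (A $ i $ j))) < (\<Sum>i\<in>(UNIV::'n set). 0)"
    using v(1) by (intro sum_strict_mono) (auto simp: mult_pos_neg)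
  then show ?thesis by simp
qed

lemma entropy_exponent_pos: "0 < d0"
  unfolding entropy_exponent_def two_in_words
  using sum_ln_neg[of P] sum_ln_neg[of c] c_bounds P_less_1 by (intro divide_neg_neg) auto

text \<open>The exponent \<open>d0\<close> is exactly the value for which
  \<open>ln c - ln p / d0\<close> has stationary mean zero, so its stopped sums have bounded mean.
  The stopped sums of \<open>ln p\<close> equal \<open>ln \<epsilon>\<close> up to a bounded error,
  because the stopped mass is comparable to \<open>\<epsilon>\<close>.\<close>

lemma integral_ln_stopped:
  "\<exists>C. \<forall>\<epsilon>>0. \<epsilon> \<le> 1 \<longrightarrow> \<bar>(\<integral>\<omega>. stopped_sum \<epsilon> (\<lambda>i j. ln (c $ i $ j)) \<omega> \<partial>M) - ln \<epsilon> / d0\<bar> \<le> C"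
proof -
  let ?c = "\<lambda>i j. ln (c $ i $ j)" and ?p = "\<lambda>i j. ln (P $ i $ j)"
  have "(\<Sum>i\<in>UNIV. v $ i * (\<Sum>j\<in>UNIV. P $ i $ j * (?c i j - ?p i j / d0)))
     = (\<Sum>i\<in>UNIV. v $ i * (\<Sum>j | P $ i $ j > 0. P $ i $ j * ?c i j))
     - (\<Sum>i\<in>UNIV. v $ i * (\<Sum>j | P $ i $ j > 0. P $ i $ j * ?p i j)) / d0"
    by (simp add: sum_row right_diff_distrib sum_subtractf sum_distrib_left sum_divide_distrib)
  also have "\<dots> = 0"
    using sum_ln_neg[of P] sum_ln_neg[of c] c_bounds P_less_1 entropy_exponent_pos
    unfolding entropy_exponent_def two_in_words by (simp add: field_simps)
  finally have "(\<Sum>i\<in>UNIV. v $ i * (\<Sum>j\<in>UNIV. P $ i $ j * (?c i j - ?p i j / d0))) = 0" .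
  from integral_stopped_sum_bounded[OF irreducible v this] obtain C where C: "\<And>\<epsilon>. \<epsilon> > 0 \<Longrightarrow> \<bar>\<integral>\<omega>. stopped_sum \<epsilon> (\<lambda>i j. ?c i j - ?p i j / d0) \<omega> \<partial>M\<bar> \<le> C"
    by blast
  obtain b where b: "0 < b" "b \<le> 1"
    "\<And>\<epsilon> \<omega>. \<epsilon> > 0 \<Longrightarrow> \<epsilon> \<le> 1 \<Longrightarrow> \<omega> \<in> inf_words P \<Longrightarrow> b * \<epsilon> \<le> mass (init_seg \<omega> (Suc (stop \<epsilon> \<omega>)))"
    using mass_stop_lower by blast
  obtain a where a: "0 < a" "a < 1" "\<And>i. i \<in> UNIV \<Longrightarrow> a \<le> q $ i"
    by (rule finite_pos_lower_bound[of UNIV "\<lambda>i. q $ i"]) (simp_all add: q_pos)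
  \<comment> \<open>The part \<open>- ln b\<close> pays for the overshoot below
    \<open>\<epsilon>\<close> at stopping, and \<open>- ln a\<close> for the initial probability,
    which is a factor of the mass but not of \<open>word_prod\<close>.\<close>
  define B where "B = - ln b - ln a"
  have "\<bar>(\<integral>\<omega>. stopped_sum \<epsilon> ?c \<omega> \<partial>M) - ln \<epsilon> / d0\<bar> \<le> C + B / d0" if e: "\<epsilon> > 0" "\<epsilon> \<le> 1" for \<epsilon>
  proof -
    have bd: "\<bar>stopped_sum \<epsilon> ?p \<omega> - ln \<epsilon>\<bar> \<le> B" if w: "\<omega> \<in> inf_words P" for \<omega>
    proof -
      let ?\<sigma> = "init_seg \<omega> (Suc (stop \<epsilon> \<omega>))"
      have "0 < word_prod P ?\<sigma>"
        unfolding word_prod_init_seg by (intro prod_pos P_inf_words[OF w])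
      then have m: "ln (mass ?\<sigma>) = ln (q $ \<omega> 0) + stopped_sum \<epsilon> ?p \<omega>"
        using q_pos[of "\<omega> 0"] ln_word_prod_stop[OF w, of P \<epsilon>] by (simp add: ln_mult)
      have "ln (b * \<epsilon>) \<le> ln (mass ?\<sigma>)" using b(1,3) e w by (intro ln_mono) auto
      then have "ln b + ln \<epsilon> \<le> ln (mass ?\<sigma>)" using b(1) e by (simp add: ln_mult)
      moreover have "ln (mass ?\<sigma>) \<le> ln \<epsilon>" using mass_stop[OF e(1) w] mass_pos[OF w] e by (intro ln_mono) auto
      moreover have "ln a \<le> ln (q $ \<omega> 0)" using a by (intro ln_mono) auto
      moreover have "q $ \<omega> 0 \<le> 1" using mass_le_1[OF w, of 0] by simp
      then have "ln (q $ \<omega> 0) \<le> 0" using q_pos by simp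
      moreover have "ln b \<le> 0" "ln a \<le> 0" using a b by simp_all
      ultimately show ?thesis unfolding m B_def by linarith
    qed
    have "\<bar>(\<integral>\<omega>. stopped_sum \<epsilon> ?p \<omega> \<partial>M) - ln \<epsilon>\<bar> = \<bar>\<integral>\<omega>. stopped_sum \<epsilon> ?p \<omega> - ln \<epsilon> \<partial>M\<bar>"
      by (simp add: integrable_stopped_sum e prob_space)
    also have "\<dots> \<le> (\<integral>\<omega>. \<bar>stopped_sum \<epsilon> ?p \<omega> - ln \<epsilon>\<bar> \<partial>M)" by (rule integral_abs_bound)
    also have "\<dots> \<le> (\<integral>\<omega>. B \<partial>M)"
      by (intro integral_mono integrable_abs Bochner_Integration.integrable_diff integrable_stopped_sum e)
        (auto simp: space_M bd)
    finally have "\<bar>(\<integral>\<omega>. stopped_sum \<epsilon> ?p \<omega> \<partial>M) - ln \<epsilon>\<bar> \<le> B" by (simp add: prob_space)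
    then have 1: "\<bar>(\<integral>\<omega>. stopped_sum \<epsilon> ?p \<omega> \<partial>M) / d0 - ln \<epsilon> / d0\<bar> \<le> B / d0"
      using entropy_exponent_pos by (simp add: divide_right_mono flip: diff_divide_distrib)
    have "stopped_sum \<epsilon> (\<lambda>i j. ?c i j - ?p i j / d0) = (\<lambda>\<omega>. stopped_sum \<epsilon> ?c \<omega> - stopped_sum \<epsilon> ?p \<omega> / d0)"
      by (simp add: fun_eq_iff stopped_sum_def sum_subtractf sum_divide_distrib)
    then have "(\<integral>\<omega>. stopped_sum \<epsilon> (\<lambda>i j. ?c i j - ?p i j / d0) \<omega> \<partial>M)
       = (\<integral>\<omega>. stopped_sum \<epsilon> ?c \<omega> \<partial>M) - (\<integral>\<omega>. stopped_sum \<epsilon> ?p \<omega> \<partial>M) / d0"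
      by (simp add: integrable_stopped_sum e)
    with C[OF e(1)] 1 show ?thesis by linarith
  qed
  then show ?thesis by blast
qed

lemma geo_mean_error_upper:
  "\<exists>C. eventually (\<lambda>n. geo_mean_error nrm (markov_type_measure J M) n \<le> ereal (exp (C - ln (real n) / d0))) sequentially"
proof -
  obtain b where b: "0 < b" "b \<le> 1"
    "\<And>\<epsilon> \<omega>. \<epsilon> > 0 \<Longrightarrow> \<epsilon> \<le> 1 \<Longrightarrow> \<omega> \<in> inf_words P \<Longrightarrow> b * \<epsilon> \<le> mass (init_seg \<omega> (Suc (stop \<epsilon> \<omega>)))"
    using mass_stop_lower by blast
  obtain C where C: "\<And>\<epsilon>. \<epsilon> > 0 \<Longrightarrow> \<epsilon> \<le> 1 \<Longrightarrow>
      \<bar>(\<integral>\<omega>. stopped_sum \<epsilon> (\<lambda>i j. ln (c $ i $ j)) \<omega> \<partial>M) - ln \<epsilon> / d0\<bar> \<le> C"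
    using integral_ln_stopped by blast
  obtain a D where D: "0 < a" "0 < D" "\<And>i. a \<le> diam [i] \<and> diam [i] \<le> D" using diam_single_bounds by blast
  have "geo_mean_error nrm (markov_type_measure J M) n \<le> ereal (exp ((ln D + C - ln b / d0) - ln (real n) / d0))"
    if n: "real n \<ge> 1 / b" for n
  proof -
    have n0: "0 < real n" using n b(1) by (meson less_le_trans zero_less_divide_1_iff)
    \<comment> \<open>With this choice each stopped cylinder has mass at least
      \<open>b * \<epsilon> = 1 / n\<close>, so at most \<open>n\<close> of them are disjoint. The
      condition \<open>n \<ge> 1 / b\<close> ensures \<open>\<epsilon> \<le> 1\<close>.\<close>
    define \<epsilon> where "\<epsilon> = 1 / (b * real n)"
    have e: "0 < \<epsilon>" "\<epsilon> \<le> 1" using n b n0 by (auto simp: \<epsilon>_def field_simps)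
    define \<sigma> where "\<sigma> \<omega> = init_seg \<omega> (Suc (stop \<epsilon> \<omega>))" for \<omega> :: "nat \<Rightarrow> 'n"
    define \<Lambda> where "\<Lambda> = \<sigma> ` inf_words P"
    have mem: "\<tau> \<in> words P (Suc (length \<tau> - 1))" "b * \<epsilon> \<le> mass \<tau>" "cyl \<tau> \<subseteq> {\<omega> \<in> inf_words P. \<sigma> \<omega> = \<tau>}"
      if \<tau>: "\<tau> \<in> \<Lambda>" for \<tau>
    proof -
      obtain \<omega>0 where w: "\<omega>0 \<in> inf_words P" "\<tau> = \<sigma> \<omega>0" using \<tau> by (auto simp: \<Lambda>_def)
      show "\<tau> \<in> words P (Suc (length \<tau> - 1))" using init_seg_in_words[OF w(1)] by (simp add: w \<sigma>_def)
      show "b * \<epsilon> \<le> mass \<tau>" using b(3)[OF e w(1)] by (simp add: w \<sigma>_def)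
      show "cyl \<tau> \<subseteq> {\<omega> \<in> inf_words P. \<sigma> \<omega> = \<tau>}"
      proof clarify
        fix \<omega> assume w': "\<omega> \<in> inf_words P" "init_seg \<omega> (length \<tau>) = \<tau>"
        then have "init_seg \<omega> (Suc (stop \<epsilon> \<omega>0)) = init_seg \<omega>0 (Suc (stop \<epsilon> \<omega>0))" by (simp add: w \<sigma>_def)
        with stop_eq_if_agree[OF e(1) w(1) w'(1)] show "\<sigma> \<omega> = \<tau>" by (simp add: w \<sigma>_def)
      qed
    qed
    \<comment> \<open>The count is made for finite subfamilies first, since finiteness of
      \<open>\<Lambda>\<close> is itself deduced from this uniform bound.\<close>
    have card: "finite F \<Longrightarrow> card F \<le> n" if F: "F \<subseteq> \<Lambda>" for F
    proof -
      assume fin: "finite F"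
      have "disjoint_family_on cyl F"
        unfolding disjoint_family_on_def
      proof (intro ballI impI equals0I)
        fix \<tau> \<tau>' \<omega> assume "\<tau> \<in> F" "\<tau>' \<in> F" "\<tau> \<noteq> \<tau>'" "\<omega> \<in> cyl \<tau> \<inter> cyl \<tau>'"
        then show False using mem(3)[of \<tau>] mem(3)[of \<tau>'] F by auto
      qed
      then have "(\<Sum>\<tau>\<in>F. measure M (cyl \<tau>)) = measure M (\<Union>\<tau>\<in>F. cyl \<tau>)"
        by (intro finite_measure_finite_Union[symmetric] fin) auto
      also have "\<dots> \<le> 1" by (rule prob_le_1)
      finally have "(\<Sum>\<tau>\<in>F. measure M (cyl \<tau>)) \<le> 1" .
      moreover have "(\<Sum>\<tau>\<in>F. b * \<epsilon>) \<le> (\<Sum>\<tau>\<in>F. measure M (cyl \<tau>))"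
      proof (rule sum_mono)
        fix \<tau> assume "\<tau> \<in> F"
        then have "\<tau> \<in> \<Lambda>" using F by blast
        show "b * \<epsilon> \<le> measure M (cyl \<tau>)" using mem(2)[OF \<open>\<tau> \<in> \<Lambda>\<close>] measure_cyl[OF mem(1)[OF \<open>\<tau> \<in> \<Lambda>\<close>]] by simp
      qed
      ultimately have "real (card F) * (b * \<epsilon>) \<le> 1" by simp
      then show "card F \<le> n" using b n0 by (simp add: \<epsilon>_def field_simps)
    qed
    have fin: "finite \<Lambda>" using card by (metis infinite_arbitrarily_large not_less_eq_eq order_refl)
    define p where "p \<tau> = (SOME x. x \<in> J \<tau>)" for \<tau>
    have p: "p \<tau> \<in> J \<tau>" if "\<tau> \<in> \<Lambda>" for \<tau>
      unfolding p_def using J_word(1)[OF mem(1)[OF that]] by (simp add: some_in_eq)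
    obtain \<omega>0 where "\<omega>0 \<in> inf_words P" using not_empty by (auto simp: space_M)
    then have ne: "\<Lambda> \<noteq> {}" by (auto simp: \<Lambda>_def)
    define \<alpha> where "\<alpha> = p ` \<Lambda>"
    have \<alpha>: "finite \<alpha>" "\<alpha> \<noteq> {}" "card \<alpha> \<le> n"
      using fin ne card[OF order_refl fin] card_image_le[OF fin, of p] by (auto simp: \<alpha>_def)
    let ?f = "\<lambda>x. elog (ereal (ninfdist nrm x \<alpha>))"
    have "ereal_integral (markov_type_measure J M) ?f = ereal_integral M (\<lambda>\<omega>. ?f (g \<omega>))"
      unfolding markov_type_measure_def
      by (rule ereal_integral_distr[OF measurable_coding_map borel_measurable_elog_ninfdist[OF norm \<alpha>(1,2)]])
    also have "\<dots> \<le> ereal (\<integral>\<omega>. ln D + stopped_sum \<epsilon> (\<lambda>i j. ln (c $ i $ j)) \<omega> \<partial>M)"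
    proof (rule ereal_integral_upper)
      show "(\<lambda>\<omega>. ?f (g \<omega>)) \<in> borel_measurable M"
        by (rule measurable_compose[OF measurable_coding_map borel_measurable_elog_ninfdist[OF norm \<alpha>(1,2)]])
      show "integrable M (\<lambda>\<omega>. ln D + stopped_sum \<epsilon> (\<lambda>i j. ln (c $ i $ j)) \<omega>)"
        using e integrable_stopped_sum by simp
      fix \<omega> assume "\<omega> \<in> space M"
      then have w: "\<omega> \<in> inf_words P" by (simp add: space_M)
      have s: "\<sigma> \<omega> \<in> \<Lambda>" using w by (simp add: \<Lambda>_def)
      have "ninfdist nrm (g \<omega>) \<alpha> \<le> ndist nrm (g \<omega>) (p (\<sigma> \<omega>))"
        unfolding ninfdist_Min[OF \<alpha>(1,2)] using \<alpha>(1) s by (intro Min_le) (auto simp: \<alpha>_def)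
      also have "\<dots> \<le> diam (\<sigma> \<omega>)"
        using p[OF s] coding_map_mem[OF w] J_init_seg(2)[OF w] unfolding \<sigma>_def
        by (intro ndist_le_ndiameter[OF norm]) auto
      also have "\<dots> \<le> word_prod c (\<sigma> \<omega>) * D"
        unfolding \<sigma>_def diam_init_seg[OF w] using D(3) word_prod_c_pos[OF w] by (simp add: mult_left_mono less_imp_le)
      finally have "?f (g \<omega>) \<le> ereal (ln (word_prod c (\<sigma> \<omega>) * D))"
        using D word_prod_c_pos[OF w] by (intro elog_mono) (auto simp: \<sigma>_def)
      also have "ln (word_prod c (\<sigma> \<omega>) * D) = ln D + stopped_sum \<epsilon> (\<lambda>i j. ln (c $ i $ j)) \<omega>"
        unfolding \<sigma>_def using ln_word_prod_stop[OF w, of c \<epsilon>] c_bounds(1) D(2) word_prod_c_pos[OF w, of "stop \<epsilon> \<omega>"] by (simp add: ln_mult)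
      finally show "?f (g \<omega>) \<le> ereal (ln D + stopped_sum \<epsilon> (\<lambda>i j. ln (c $ i $ j)) \<omega>)" .
    qed
    also have "\<dots> = ereal (ln D + (\<integral>\<omega>. stopped_sum \<epsilon> (\<lambda>i j. ln (c $ i $ j)) \<omega> \<partial>M))"
      using e integrable_stopped_sum by (simp add: prob_space)
    also have "\<dots> \<le> ereal ((ln D + C - ln b / d0) - ln (real n) / d0)"
    proof -
      have "ln \<epsilon> = - ln b - ln (real n)" using b n0 by (simp add: \<epsilon>_def ln_div ln_mult)
      then have "ln \<epsilon> / d0 = - ln b / d0 - ln (real n) / d0" by (simp add: diff_divide_distrib)
      then show ?thesis using C[OF e] by simp
    qed
    finally have "eexp (ereal_integral (markov_type_measure J M) ?f) \<le> ereal (exp ((ln D + C - ln b / d0) - ln (real n) / d0))"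
      by (rule eexp_mono_upper)
    moreover have "1 \<le> card \<alpha>" using \<alpha> by (simp add: Suc_le_eq card_gt_0_iff)
    ultimately show ?thesis
      unfolding geo_mean_error_def using \<alpha> by (intro INF_lower2[of \<alpha>]) auto
  qed
  moreover have "eventually (\<lambda>n. real n \<ge> 1 / b) sequentially"
    using filterlim_real_sequentially by (simp add: filterlim_at_top)
  ultimately show ?thesis
    by (intro exI[of _ "ln D + C - ln b / d0"]) (auto elim: eventually_mono)
qed

end

text \<open>The bounds say that \<open>- ln (e n)\<close> is \<open>ln n / s\<close> up to a bounded
  error. Dividing by \<open>ln n\<close> gives the dimension, and multiplying \<open>e n\<close> by
  \<open>n powr (1 / s) = exp (ln n / s)\<close> leaves values between \<open>exp A\<close> and
  \<open>exp B\<close>.\<close>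

lemma quantization_asymptotics:
  fixes e :: "nat \<Rightarrow> ereal" and s A B :: real
  assumes s: "0 < s"
    and lower: "eventually (\<lambda>n. ereal (exp (A - ln (real n) / s)) \<le> e n) sequentially"
    and upper: "eventually (\<lambda>n. e n \<le> ereal (exp (B - ln (real n) / s))) sequentially"
  shows "(\<lambda>n. ereal (ln (real n)) / (- elog (e n))) \<longlonglongrightarrow> ereal s"
    and "0 < liminf (\<lambda>n. ereal (real n powr (1 / s)) * e n)"
    and "limsup (\<lambda>n. ereal (real n powr (1 / s)) * e n) < \<infinity>"
proof -
  define r where "r n = real_of_ereal (e n)" for n
  have ln_top: "filterlim (\<lambda>n. ln (real n)) at_top sequentially"
    by (rule filterlim_compose[OF ln_at_top filterlim_real_sequentially])
  have ln_pos: "eventually (\<lambda>n. 0 < ln (real n) \<and> 0 < ln (real n) / s - B) sequentially"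
  proof -
    \<comment> \<open>Beyond this threshold \<open>ln n / s - B\<close> is at least 1, so
      \<open>- ln (r n)\<close> is positive and the quotient in \<open>ereal\<close> agrees with the
      real one.\<close>
    have "eventually (\<lambda>n. max 1 (s * (B + 1)) \<le> ln (real n)) sequentially"
      using ln_top unfolding filterlim_at_top by blast
    then show ?thesis by eventually_elim (use s in \<open>auto simp: field_simps\<close>)
  qed
  have er: "eventually (\<lambda>n. e n = ereal (r n) \<and> 0 < r n \<and> A - ln (real n) / s \<le> ln (r n) \<and> ln (r n) \<le> B - ln (real n) / s) sequentially"
    using lower upper
  proof eventually_elim
    case (elim n)
    then obtain x where x: "e n = ereal x" by (cases "e n") auto
    then have *: "exp (A - ln (real n) / s) \<le> x" "x \<le> exp (B - ln (real n) / s)" using elim by auto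
    then have "0 < x" using exp_gt_zero less_le_trans by blast
    moreover have "A - ln (real n) / s \<le> ln x" using *(1) \<open>0 < x\<close> by (simp add: ln_ge_iff)
    moreover have "ln x \<le> ln (exp (B - ln (real n) / s))" using *(2) \<open>0 < x\<close> by (intro ln_mono)
    ultimately show ?case by (simp add: r_def x)
  qed
  have inv: "(\<lambda>n. K / ln (real n)) \<longlonglongrightarrow> 0" for K :: real
    by (rule tendsto_divide_0[OF tendsto_const filterlim_at_top_imp_at_infinity[OF ln_top]])
  have "(\<lambda>n. - ln (r n) / ln (real n)) \<longlonglongrightarrow> 1 / s"
  proof (rule tendsto_sandwich)
    show "(\<lambda>n. 1 / s - B / ln (real n)) \<longlonglongrightarrow> 1 / s" "(\<lambda>n. 1 / s - A / ln (real n)) \<longlonglongrightarrow> 1 / s"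
      using tendsto_diff[OF tendsto_const inv, of "1 / s"] by simp_all
    show "eventually (\<lambda>n. 1 / s - B / ln (real n) \<le> - ln (r n) / ln (real n)) sequentially"
      using er ln_pos
    proof eventually_elim
      case (elim n)
      have "1 / s - B / ln (real n) = (ln (real n) / s - B) / ln (real n)"
        using elim by (simp add: diff_divide_distrib)
      also have "\<dots> \<le> - ln (r n) / ln (real n)" using elim by (intro divide_right_mono) auto
      finally show ?case .
    qed
    show "eventually (\<lambda>n. - ln (r n) / ln (real n) \<le> 1 / s - A / ln (real n)) sequentially"
      using er ln_pos
    proof eventually_elim
      case (elim n)
      have "- ln (r n) / ln (real n) \<le> (ln (real n) / s - A) / ln (real n)"
        using elim by (intro divide_right_mono) auto
      also have "\<dots> = 1 / s - A / ln (real n)"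
        using elim by (simp add: diff_divide_distrib)
      finally show ?case .
    qed
  qed
  then have "(\<lambda>n. inverse (- ln (r n) / ln (real n))) \<longlonglongrightarrow> inverse (1 / s)"
    using s by (intro tendsto_inverse) auto
  then have "(\<lambda>n. ereal (ln (real n) / (- ln (r n)))) \<longlonglongrightarrow> ereal s"
    by (intro tendsto_ereal) (simp add: inverse_eq_divide)
  then show "(\<lambda>n. ereal (ln (real n)) / (- elog (e n))) \<longlonglongrightarrow> ereal s"
  proof (rule Lim_transform_eventually)
    show "eventually (\<lambda>n. ereal (ln (real n) / (- ln (r n))) = ereal (ln (real n)) / (- elog (e n))) sequentially"
      using er ln_pos
    proof eventually_elim
      case (elim n)
      then have "- ln (r n) \<noteq> 0" by linarith
      then show ?case using elim by (simp add: elog_ereal)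
    qed
  qed
  have powr: "eventually (\<lambda>n. real n powr (1 / s) = exp (ln (real n) / s)) sequentially"
    using eventually_gt_at_top[of 0] by eventually_elim (simp add: powr_def)
  have "eventually (\<lambda>n. ereal (exp A) \<le> ereal (real n powr (1 / s)) * e n) sequentially"
    using er powr
  proof eventually_elim
    case (elim n)
    then have "exp A \<le> exp (ln (real n) / s + ln (r n))" by simp
    then show ?case using elim by (simp add: exp_add)
  qed
  from Liminf_bounded[OF this] show "0 < liminf (\<lambda>n. ereal (real n powr (1 / s)) * e n)"
    by (rule less_le_trans[rotated]) simp
  have "eventually (\<lambda>n. ereal (real n powr (1 / s)) * e n \<le> ereal (exp B)) sequentially"
    using er powr
  proof eventually_elim
    case (elim n)
    then have "exp (ln (real n) / s + ln (r n)) \<le> exp B" by simp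
    then show ?case using elim by (simp add: exp_add)
  qed
  from Limsup_bounded[OF this] show "limsup (\<lambda>n. ereal (real n powr (1 / s)) * e n) < \<infinity>"
    by (rule le_less_trans) simp
qed

section \<open>The lower bound\<close>

context irreducible_mw_measure
begin

text \<open>Compare the logarithmic distance to \<open>\<alpha>\<close> with the logarithmic
  diameter at stopping. Coming closer by another \<open>k\<close> levels costs at most a multiple of
  \<open>k\<close>, and is possible only on sets whose mass decays geometrically in
  \<open>k\<close>.\<close>

lemma geo_mean_error_lower:
  "\<exists>C. \<forall>n\<ge>1. ereal (exp (C - ln (real n) / d0)) \<le> geo_mean_error nrm (markov_type_measure J M) n"
proof -
  obtain r where r: "0 < r" "r < 1"
    "\<And>\<epsilon> a k. \<epsilon> > 0 \<Longrightarrow> \<exists>C\<in>sets M. near \<epsilon> a k \<subseteq> C \<and> measure M C \<le> \<epsilon> * r ^ k"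
    using near_in_small_cylinder by blast
  obtain \<rho> where \<rho>: "0 < \<rho>" "\<rho> < 1" "\<And>\<omega> k l. \<omega> \<in> inf_words P \<Longrightarrow>
     word_prod c (init_seg \<omega> (Suc k)) * \<rho> ^ l \<le> word_prod c (init_seg \<omega> (Suc (k + l)))"
    using word_prod_c_lower by blast
  obtain a D where D: "0 < a" "0 < D" "\<And>i. a \<le> diam [i] \<and> diam [i] \<le> D" using diam_single_bounds by blast
  obtain C where C: "\<And>\<epsilon>. \<epsilon> > 0 \<Longrightarrow> \<epsilon> \<le> 1 \<Longrightarrow>
      \<bar>(\<integral>\<omega>. stopped_sum \<epsilon> (\<lambda>i j. ln (c $ i $ j)) \<omega> \<partial>M) - ln \<epsilon> / d0\<bar> \<le> C"
    using integral_ln_stopped by blast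
  \<comment> \<open>\<open>L\<close> bounds the decrease of the logarithm of
    \<open>word_prod c\<close> from one level to the next.\<close>
  define L where "L = - ln \<rho>"
  have L: "0 < L" using \<rho> by (simp add: L_def)
  define b where "b = t / 2 * a"
  have b: "0 < b" using D t_pos by (simp add: b_def)
  \<comment> \<open>The sum of the geometric series with terms \<open>L * r ^ k\<close>: one point
    of \<open>\<alpha>\<close> costs at most \<open>B * \<epsilon>\<close>, and \<open>n\<close>
    points with \<open>\<epsilon> = 1 / n\<close> cost at most \<open>B\<close> together.\<close>
  define B where "B = L / (1 - r)"
  have B: "0 \<le> B" using L r by (simp add: B_def)
  have "ereal (exp ((ln b - C - B) - ln (real n) / d0)) \<le> geo_mean_error nrm (markov_type_measure J M) n"
    if n: "n \<ge> 1" for n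
    unfolding geo_mean_error_def
  proof (rule INF_greatest)
    fix \<alpha> :: "(real^'d) set" assume "\<alpha> \<in> {\<alpha>. finite \<alpha> \<and> 1 \<le> card \<alpha> \<and> card \<alpha> \<le> n}"
    then have \<alpha>: "finite \<alpha>" "\<alpha> \<noteq> {}" "card \<alpha> \<le> n" by auto
    define \<epsilon> where "\<epsilon> = 1 / real n"
    have e: "0 < \<epsilon>" "\<epsilon> \<le> 1" using n by (simp_all add: \<epsilon>_def)
    obtain S where S: "\<And>x k. S x k \<in> sets M" "\<And>x k. near \<epsilon> x k \<subseteq> S x k" "\<And>x k. measure M (S x k) \<le> \<epsilon> * r ^ k"
    proof -
      have "\<forall>x k. \<exists>C. C \<in> sets M \<and> near \<epsilon> x k \<subseteq> C \<and> measure M C \<le> \<epsilon> * r ^ k"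
        using r(3)[OF e(1)] by blast
      then obtain S where "\<forall>x k. S x k \<in> sets M \<and> near \<epsilon> x k \<subseteq> S x k \<and> measure M (S x k) \<le> \<epsilon> * r ^ k"
        unfolding choice_iff by blast
      then show thesis using that by blast
    qed
    note S(1) [measurable]
    \<comment> \<open>Bounds the loss in the logarithmic distance caused by sequences mapped very close to \<open>\<alpha>\<close>.\<close>
    define R where "R \<omega> = (\<Sum>x\<in>\<alpha>. \<Sum>k. ennreal L * indicator (S x k) \<omega>)" for \<omega>
    have [measurable]: "R \<in> borel_measurable M" unfolding R_def by measurable
    have "(\<integral>\<^sup>+\<omega>. (\<Sum>k. ennreal L * indicator (S x k) \<omega>) \<partial>M) = (\<Sum>k. ennreal L * emeasure M (S x k))" for x
      by (subst nn_integral_suminf) (measurable, simp only: nn_integral_cmult_indicator[OF S(1)])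
    moreover have "(\<lambda>\<omega>. \<Sum>k. ennreal L * indicator (S x k) \<omega>) \<in> borel_measurable M" for x
      by measurable
    ultimately have "(\<integral>\<^sup>+\<omega>. R \<omega> \<partial>M) = (\<Sum>x\<in>\<alpha>. \<Sum>k. ennreal L * emeasure M (S x k))"
      unfolding R_def by (simp only: nn_integral_sum)
    also have "\<dots> \<le> (\<Sum>x\<in>\<alpha>. ennreal (B * \<epsilon>))"
    proof (rule sum_mono)
      fix x
      have "(\<Sum>k. ennreal L * emeasure M (S x k)) \<le> (\<Sum>k. ennreal (L * \<epsilon> * r ^ k))"
      proof (rule suminf_le)
        fix k
        have "ennreal L * emeasure M (S x k) \<le> ennreal L * ennreal (\<epsilon> * r ^ k)"
          unfolding emeasure_eq_measure using S(3) by (intro mult_left_mono ennreal_leI) auto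
        then show "ennreal L * emeasure M (S x k) \<le> ennreal (L * \<epsilon> * r ^ k)"
          using L e r by (simp add: ennreal_mult mult.assoc)
      qed auto
      also have "\<dots> = ennreal (\<Sum>k. L * \<epsilon> * r ^ k)"
        using L e r by (intro suminf_ennreal2 summable_mult summable_geometric) auto
      also have "(\<Sum>k. L * \<epsilon> * r ^ k) = B * \<epsilon>"
        using r by (subst suminf_mult) (simp_all add: suminf_geometric B_def summable_geometric)
      finally show "(\<Sum>k. ennreal L * emeasure M (S x k)) \<le> ennreal (B * \<epsilon>)" .
    qed
    also have "\<dots> = ennreal (real (card \<alpha>) * (B * \<epsilon>))"
      using B e by (simp add: ennreal_mult ennreal_of_nat_eq_real_of_nat)
    also have "\<dots> \<le> ennreal B"
    proof (rule ennreal_leI)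
      have "real (card \<alpha>) * (B * \<epsilon>) \<le> real n * (B * \<epsilon>)"
        using \<alpha>(3) B e by (intro mult_right_mono) auto
      then show "real (card \<alpha>) * (B * \<epsilon>) \<le> B" using n by (simp add: \<epsilon>_def)
    qed
    finally have RB: "(\<integral>\<^sup>+\<omega>. R \<omega> \<partial>M) \<le> ennreal B" .

    let ?f = "\<lambda>x. elog (ereal (ninfdist nrm x \<alpha>))"
    let ?w = "\<lambda>\<omega>. ln b + stopped_sum \<epsilon> (\<lambda>i j. ln (c $ i $ j)) \<omega>"
    have "ereal ((\<integral>\<omega>. ?w \<omega> \<partial>M) - B) \<le> ereal_integral M (\<lambda>\<omega>. ?f (g \<omega>))"
    proof (rule ereal_integral_lower[OF _ \<open>R \<in> borel_measurable M\<close> _ RB B])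
      show "(\<lambda>\<omega>. ?f (g \<omega>)) \<in> borel_measurable M"
        by (rule measurable_compose[OF measurable_coding_map borel_measurable_elog_ninfdist[OF norm \<alpha>(1,2)]])
      show "integrable M ?w" using e integrable_stopped_sum by simp
      fix \<omega> assume "\<omega> \<in> space M"
      then have w: "\<omega> \<in> inf_words P" by (simp add: space_M)
      \<comment> \<open>Since \<open>b = t / 2 * a\<close> and \<open>a\<close> bounds the diameters
        of the initial sets from below, \<open>W * \<rho> ^ k\<close> is a lower bound for the
        radius that defines \<open>near \<epsilon> x k\<close> at \<open>\<omega>\<close>.\<close>
      define W where "W = b * word_prod c (init_seg \<omega> (Suc (stop \<epsilon> \<omega>)))"
      have W: "0 < W" using b word_prod_c_pos[OF w] by (simp add: W_def)
      have lnW: "ln W = ?w \<omega>"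
        unfolding W_def using ln_word_prod_stop[OF w, of c \<epsilon>] c_bounds(1) b word_prod_c_pos[OF w, of "stop \<epsilon> \<omega>"] by (simp add: ln_mult)
      have "ninfdist nrm (g \<omega>) \<alpha> \<in> ndist nrm (g \<omega>) ` \<alpha>"
        unfolding ninfdist_Min[OF \<alpha>(1,2)] using \<alpha> by (intro Min_in) auto
      then obtain x where x: "x \<in> \<alpha>" "ninfdist nrm (g \<omega>) \<alpha> = ndist nrm (g \<omega>) x" by blast
      define \<delta> where "\<delta> = ndist nrm (g \<omega>) x"
      have \<delta>: "0 \<le> \<delta>" using ndist_nonneg[OF norm] by (simp add: \<delta>_def)
      have mem: "\<omega> \<in> S x k" if "\<delta> < W * \<rho> ^ k" for k
      proof -
        have "W * \<rho> ^ k = t / 2 * ((word_prod c (init_seg \<omega> (Suc (stop \<epsilon> \<omega>))) * \<rho> ^ k) * a)"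
          by (simp add: W_def b_def)
        also have "\<dots> \<le> t / 2 * (word_prod c (init_seg \<omega> (Suc (stop \<epsilon> \<omega> + k))) * diam [\<omega> (stop \<epsilon> \<omega> + k)])"
          using D(1,3) t_pos \<rho>(3)[OF w] less_imp_le[OF word_prod_c_pos[OF w]] by (intro mult_left_mono mult_mono) auto
        also have "\<dots> = t / 2 * diam (init_seg \<omega> (Suc (stop \<epsilon> \<omega> + k)))" by (simp add: diam_init_seg[OF w])
        finally have "\<omega> \<in> near \<epsilon> x k" using that w by (simp add: near_def \<delta>_def)
        then show ?thesis using S(2) by blast
      qed
      \<comment> \<open>Every level \<open>k < K\<close> puts \<open>\<omega>\<close> into
        \<open>S x k\<close> and so contributes one summand \<open>L\<close> to the
        remainder.\<close>
      have RK: "ennreal (L * real K) \<le> R \<omega>" if K: "\<And>k. k < K \<Longrightarrow> \<delta> < W * \<rho> ^ k" for K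
      proof -
        have "ennreal (L * real K) = (\<Sum>k<K. ennreal L)"
          using L by (simp add: ennreal_mult ennreal_of_nat_eq_real_of_nat mult.commute)
        also have "\<dots> = (\<Sum>k<K. ennreal L * indicator (S x k) \<omega>)"
          by (rule sum.cong) (use K mem in auto)
        also have "\<dots> \<le> (\<Sum>k. ennreal L * indicator (S x k) \<omega>)" by (rule sum_le_suminf) auto
        also have "\<dots> \<le> R \<omega>" unfolding R_def by (rule member_le_sum) (use x(1) \<alpha>(1) in auto)
        finally show ?thesis .
      qed
      show "ereal (?w \<omega>) \<le> ?f (g \<omega>) + enn2ereal (R \<omega>)"
      proof (cases "R \<omega>" rule: ennreal_cases)
        case top
        then show ?thesis by (simp add: elog_ereal)
      next
        case (real y)
        \<comment> \<open>A finite remainder excludes infinitely many charges, so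
          \<open>\<delta>\<close> cannot lie below all the radii. In particular
          \<open>\<delta> = 0\<close> is excluded here; it falls under the infinite case above,
          where \<open>-\<infinity> + \<infinity> = \<infinity>\<close>.\<close>
        have "\<exists>k. W * \<rho> ^ k \<le> \<delta>"
        proof (rule ccontr)
          assume "\<not> ?thesis"
          then have "\<And>K. ennreal (L * real K) \<le> ennreal y" using RK real by (metis not_le)
          then have "\<And>K. L * real K \<le> y" using real L by (simp add: ennreal_le_iff)
          moreover obtain K where "y / L < real K" using reals_Archimedean2 by blast
          ultimately show False using L by (simp add: field_simps not_le[symmetric])
        qed
        \<comment> \<open>All levels below \<open>K\<close> have been charged, so the remainder is
          at least \<open>L * K\<close>, while \<open>ln \<delta>\<close> is at least
          \<open>ln W - L * K\<close>. The two losses cancel.\<close>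
        define K where "K = (LEAST k. W * \<rho> ^ k \<le> \<delta>)"
        have K: "W * \<rho> ^ K \<le> \<delta>" unfolding K_def by (rule LeastI_ex) fact
        have "ennreal (L * real K) \<le> ennreal y"
          using RK[of K] not_less_Least[of _ "\<lambda>k. W * \<rho> ^ k \<le> \<delta>"] unfolding K_def[symmetric] real(2) by (simp add: not_le)
        then have y: "L * real K \<le> y" using real L by (simp add: ennreal_le_iff)
        have "0 < W * \<rho> ^ K" using W \<rho> by simp
        then have "ln (W * \<rho> ^ K) \<le> ln \<delta>" "0 < \<delta>" using K by (auto intro: ln_mono)
        then have "ln W - L * real K \<le> ln \<delta>" using W \<rho> by (simp add: ln_mult ln_realpow L_def mult.commute)
        then show ?thesis using y \<open>0 < \<delta>\<close> real
          by (simp add: x(2) \<delta>_def[symmetric] elog_ereal lnW[symmetric] enn2ereal_ennreal)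
      qed
    qed
    also have "\<dots> = ereal_integral (markov_type_measure J M) ?f"
      unfolding markov_type_measure_def
      by (rule ereal_integral_distr[OF measurable_coding_map borel_measurable_elog_ninfdist[OF norm \<alpha>(1,2)], symmetric])
    finally have le: "ereal ((\<integral>\<omega>. ?w \<omega> \<partial>M) - B) \<le> ereal_integral (markov_type_measure J M) ?f" .
    have "ln \<epsilon> / d0 = - ln (real n) / d0" using n by (simp add: \<epsilon>_def ln_div)
    then have "(ln b - C - B) - ln (real n) / d0 \<le> (\<integral>\<omega>. ?w \<omega> \<partial>M) - B"
      using C[OF e] e integrable_stopped_sum by (simp add: prob_space)
    then have "ereal ((ln b - C - B) - ln (real n) / d0) \<le> ereal_integral (markov_type_measure J M) ?f"
      using le by (meson ereal_less_eq(3) order_trans)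
    then show "ereal (exp ((ln b - C - B) - ln (real n) / d0)) \<le> eexp (ereal_integral (markov_type_measure J M) ?f)"
      by (rule eexp_mono_lower)
  qed
  then show ?thesis by blast
qed

end

theorem theorem1p2:
  fixes nrm :: "real^'d \<Rightarrow> real"
    and P c :: "real^'n^'n"
    and q v :: "real^'n"
    and J :: "'n list \<Rightarrow> (real^'d) set"
    and M :: "(nat \<Rightarrow> 'n) measure"
    and \<mu> :: "(real^'d) measure"
    and s0 :: real
  assumes "is_norm nrm"
    and "row_stochastic P"
    and "\<forall>i. q $ i > 0" and "(\<Sum>i\<in>UNIV. q $ i) = 1"
    and "mauldin_williams nrm P c J"
    and "separation_property nrm P J"
    and "markov_measure P q M"
    and "\<mu> = markov_type_measure J M"
    and "\<forall>i. card {j. [i, j] \<in> words P 2} \<ge> 2"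
    and "irreducible_matrix P"
    and "\<forall>i. v $ i > 0" and "v v* P = v" and "(\<Sum>i\<in>UNIV. v $ i) = 1"
    and "s0 = entropy_exponent P c v"
  shows "has_quant_dim nrm \<mu> (ereal s0) \<and>
    0 < lower_quant_coeff nrm s0 \<mu> \<and>
    lower_quant_coeff nrm s0 \<mu> \<le> upper_quant_coeff nrm s0 \<mu> \<and>
    upper_quant_coeff nrm s0 \<mu> < \<infinity>"
proof -
  from assms(6)[unfolded separation_property_def] obtain t where t: "0 < t" and
    t_sep: "\<forall>\<sigma>\<in>all_words P. \<forall>j1 j2.
      j1 \<noteq> j2 \<and> \<sigma> @ [j1] \<in> all_words P \<and> \<sigma> @ [j2] \<in> all_words P \<longrightarrow>
        nsetdist nrm (J (\<sigma> @ [j1])) (J (\<sigma> @ [j2]))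
          \<ge> t * max (ndiameter nrm (J (\<sigma> @ [j1]))) (ndiameter nrm (J (\<sigma> @ [j2])))"
    by (elim exE conjE)
  have "card {j. P $ i $ j > 0} \<ge> 2" for i using assms(9) by simp
  then have "markov_words P q M"
    using assms(2,3,7) by (intro markov_words.intro) simp_all
  then have "mw_measure P q M nrm c J t"
    by (intro mw_measure.intro mw_measure_axioms.intro assms(1,5) t) (use t_sep in simp_all)
  then have "irreducible_mw_measure P q M nrm c J t v"
    by (intro irreducible_mw_measure.intro irreducible_mw_measure_axioms.intro assms(10,12)
        assms(11)[rule_format])
  then interpret irreducible_mw_measure P q M nrm c J t v .
  from geo_mean_error_lower
  obtain A where "\<forall>n\<ge>1. ereal (exp (A - ln (real n) / s0)) \<le> geo_mean_error nrm \<mu> n"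
    unfolding assms(8,14) by (rule exE)
  then have lower: "eventually (\<lambda>n. ereal (exp (A - ln (real n) / s0)) \<le> geo_mean_error nrm \<mu> n) sequentially"
    unfolding eventually_sequentially by (rule exI)
  from geo_mean_error_upper
  obtain B where upper: "eventually (\<lambda>n. geo_mean_error nrm \<mu> n \<le> ereal (exp (B - ln (real n) / s0))) sequentially"
    unfolding assms(8,14) by (rule exE)
  have "0 < s0" unfolding assms(14) by (rule entropy_exponent_pos)
  note * = quantization_asymptotics[OF this lower upper]
  show ?thesis
    unfolding has_quant_dim_def lower_quant_dim_def upper_quant_dim_def lower_quant_coeff_def upper_quant_coeff_def
    by (intro conjI * lim_imp_Liminf[OF sequentially_bot] lim_imp_Limsup[OF sequentially_bot]
        Liminf_le_Limsup[OF sequentially_bot])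
qed

end
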